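(* The ring $\widetilde{\mathfrak W}$, i.e. the subring of $\mathbb Z[\widetilde W]$ generated by the set of characters $\{\chi_y : y\in\widetilde{\mathcal W}^{(+)}\}$, is a commutative ring.
   Context: Setting: $sl(3)$ with simple roots $\alpha_1,\alpha_2$, $\theta=\alpha_1+\alpha_2$, $\langle\alpha_i,\alpha_i\rangle=2$, root lattice $Q$, weight lattice $P$, fundamental weights $\bar\Lambda_1,\bar\Lambda_2$, $\bar\rho=\bar\Lambda_1+\bar\Lambda_2$, dominant weights $P_+$. $\overline W$ is the finite Weyl group, shifted action $w\cdot\lambda=w(\lambda+\bar\rho)-\bar\rho$. The extended affine Weyl group is $\widetilde W=\overline W\ltimes t_P$ (with $w\,t_\beta w^{-1}=t_{w(\beta)}$), the affine Weyl group is $W=\overline W\ltimes t_Q$. Each $y\in\widetilde W$ is uniquely $y=\bar y\,t_{-\lambda}$, $\bar y\in\overline W$, $\lambda\in P$. $\mathbb Z[\widetilde W]$ is the integral group ring. $\iota:\widetilde W\to Q$, $\iota(\bar y\,t_{-\lambda})=3\lambda+\bar y^{-1}\cdot0$. $\widetilde{\mathcal W}^{(+)}=\{\bar y\,t_{-\lambda}\in\widetilde W:\lambda\in P_+,\ \langle\lambda,\alpha_i\rangle>0 \text{ whenever } \bar y(\alpha_i)\text{ is a negative root},\ i=1,2\}$; for $y\in\widetilde{\mathcal W}^{(+)}$ one has $\iota(y)\in P_+$. For $y\in\widetilde{\mathcal W}^{(+)}$, $\chi_y=\sum_{z\in Wy}\bar m^{\iota(y)}_{\iota(z)}\,z\in\mathbb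 Z[\widetilde W]$ (a finite sum), where $\bar m^\lambda_\mu$ is the multiplicity of the weight $\mu$ in the irreducible $sl(3)$-module of highest weight $\lambda\in P_+$. *)

theory Defs
  imports
    "HOL-Analysis.Analysis"
    "HOL-Library.Poly_Mapping"
    "HOL-Algebra.Generated_Rings"
begin

section \<open>Weights and the finite Weyl group\<close>

text \<open>A weight is given by its coordinates with respect to the fundamental weights, so the
  weight lattice P is the whole type. Since the simple roots have square length 2, the pairing
  of a weight with the i-th simple root is its i-th coordinate.\<close>

type_synonym weight = "int \<times> int"

definition smul :: "int \<Rightarrow> weight \<Rightarrow> weight" where
  "smul n l = (n * fst l, n * snd l)"

definition alpha1 :: weight where "alpha1 = (2, -1)"
definition alpha2 :: weight where "alpha2 = (-1, 2)"
definition rho :: weight where "rho = (1, 1)"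

definition root_lattice :: "weight set" where
  "root_lattice = {smul m alpha1 + smul n alpha2 | m n. True}"

definition dominant :: "weight set" where
  "dominant = {l. 0 \<le> fst l \<and> 0 \<le> snd l}"

definition negative_roots :: "weight set" where
  "negative_roots = {- alpha1, - alpha2, - (alpha1 + alpha2)}"

definition s1 :: "weight \<Rightarrow> weight" where "s1 l = l - smul (fst l) alpha1"
definition s2 :: "weight \<Rightarrow> weight" where "s2 l = l - smul (snd l) alpha2"

text \<open>The Weyl group is the group of transformations of P generated by the two simple
  reflections; as these are involutions, products of them already form a group.\<close>

inductive_set weyl :: "(weight \<Rightarrow> weight) set" where
  "id \<in> weyl"
| "w \<in> weyl \<Longrightarrow> s1 \<circ> w \<in> weyl"
| "w \<in> weyl \<Longrightarrow> s2 \<circ> w \<in> weyl"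

definition dot :: "(weight \<Rightarrow> weight) \<Rightarrow> weight \<Rightarrow> weight" where
  "dot w l = w (l + rho) - rho"

lemma s1_apply: "s1 (a, b) = (- a, a + b)"
  by (simp add: s1_def smul_def alpha1_def)

lemma s2_apply: "s2 (a, b) = (a + b, - b)"
  by (simp add: s2_def smul_def alpha2_def)

lemma s1_s1 [simp]: "s1 \<circ> s1 = id"
  by (auto simp: fun_eq_iff s1_apply)

lemma s2_s2 [simp]: "s2 \<circ> s2 = id"
  by (auto simp: fun_eq_iff s2_apply)

lemma weyl_add:
  assumes "w \<in> weyl" shows "w (l + m) = w l + w m"
  using assms
proof induction
  case (2 w)
  then show ?case by (cases "w l"; cases "w m") (simp add: s1_apply)
next
  case (3 w)
  then show ?case by (cases "w l"; cases "w m") (simp add: s2_apply)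
qed simp

lemma weyl_zero: "w \<in> weyl \<Longrightarrow> w 0 = 0"
  using weyl_add[of w 0 0] by simp

lemma weyl_uminus: "w \<in> weyl \<Longrightarrow> w (- l) = - w l"
  using weyl_add[of w "- l" l] weyl_zero[of w] by (simp add: eq_neg_iff_add_eq_0)

lemma weyl_comp: "u \<in> weyl \<Longrightarrow> v \<in> weyl \<Longrightarrow> u \<circ> v \<in> weyl"
  by (induction rule: weyl.induct) (auto simp: comp_assoc intro: weyl.intros)

lemma weyl_s1: "s1 \<in> weyl"
  using weyl.intros(2)[OF weyl.intros(1)] by simp

lemma weyl_s2: "s2 \<in> weyl"
  using weyl.intros(3)[OF weyl.intros(1)] by simp

lemma weyl_inverse: "w \<in> weyl \<Longrightarrow> \<exists>v\<in>weyl. v \<circ> w = id \<and> w \<circ> v = id"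
proof (induction rule: weyl.induct)
  case 1
  show ?case by (rule bexI[of _ id]) (simp_all only: weyl.intros(1) comp_id simp_thms)
next
  case (2 w)
  then obtain v where v: "v \<in> weyl" "v \<circ> w = id" "w \<circ> v = id" by blast
  have "v \<circ> s1 \<in> weyl" using v weyl_s1 weyl_comp by blast
  moreover have "(v \<circ> s1) \<circ> (s1 \<circ> w) = v \<circ> (s1 \<circ> s1) \<circ> w"
    "(s1 \<circ> w) \<circ> (v \<circ> s1) = s1 \<circ> (w \<circ> v) \<circ> s1"
    by (simp_all only: comp_assoc)
  hence "(v \<circ> s1) \<circ> (s1 \<circ> w) = id" "(s1 \<circ> w) \<circ> (v \<circ> s1) = id"
    by (simp_all only: v s1_s1 comp_id)
  ultimately show ?case by blast
next
  case (3 w)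
  then obtain v where v: "v \<in> weyl" "v \<circ> w = id" "w \<circ> v = id" by blast
  have "v \<circ> s2 \<in> weyl" using v weyl_s2 weyl_comp by blast
  moreover have "(v \<circ> s2) \<circ> (s2 \<circ> w) = v \<circ> (s2 \<circ> s2) \<circ> w"
    "(s2 \<circ> w) \<circ> (v \<circ> s2) = s2 \<circ> (w \<circ> v) \<circ> s2"
    by (simp_all only: comp_assoc)
  hence "(v \<circ> s2) \<circ> (s2 \<circ> w) = id" "(s2 \<circ> w) \<circ> (v \<circ> s2) = id"
    by (simp_all only: v s2_s2 comp_id)
  ultimately show ?case by blast
qed

lemma weyl_bij: "w \<in> weyl \<Longrightarrow> bij w"
  using weyl_inverse o_bij by blast

lemma weyl_inv: assumes "w \<in> weyl" shows "inv_into UNIV w \<in> weyl"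
proof -
  obtain v where v: "v \<in> weyl" "v \<circ> w = id" "w \<circ> v = id"
    using weyl_inverse[OF assms] by blast
  have "inv_into UNIV w = v" by (rule inv_unique_comp) (use v in simp_all)
  with v show ?thesis by simp
qed


section \<open>The extended affine Weyl group and its group ring\<close>

text \<open>The pair \<open>(w, b)\<close> stands for \<open>w t_b\<close>. The group is written additively (although it is
  not commutative) because the convolution product on finitely supported functions in
  \<^theory>\<open>HOL-Library.Poly_Mapping\<close> is formed from the class \<^class>\<open>monoid_add\<close>: with this
  convention \<open>ext_weyl \<Rightarrow>\<^sub>0 int\<close> is the integral group ring.\<close>

typedef ext_weyl = "weyl \<times> (UNIV :: weight set)"
  using weyl.intros(1) by auto

setup_lifting type_definition_ext_weyl

lift_definition fin_part :: "ext_weyl \<Rightarrow> weight \<Rightarrow> weight" is fst .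
lift_definition trans_part :: "ext_weyl \<Rightarrow> weight" is snd .
lift_definition transl :: "weight \<Rightarrow> ext_weyl" is "\<lambda>b. (id, b)"
  by (simp add: weyl.intros(1))

instantiation ext_weyl :: group_add
begin

lift_definition zero_ext_weyl :: ext_weyl is "(id, 0)"
  by (simp add: weyl.intros(1))

text \<open>\<open>(u t_b) (v t_c) = u v t_{v^{-1}(b) + c}\<close>\<close>

lift_definition plus_ext_weyl :: "ext_weyl \<Rightarrow> ext_weyl \<Rightarrow> ext_weyl"
  is "\<lambda>x y. (fst x \<circ> fst y, inv_into UNIV (fst y) (snd x) + snd y)"
  by (auto intro: weyl_comp)

lift_definition uminus_ext_weyl :: "ext_weyl \<Rightarrow> ext_weyl"
  is "\<lambda>x. (inv_into UNIV (fst x), - fst x (snd x))"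
  by (auto intro: weyl_inv)

definition minus_ext_weyl :: "ext_weyl \<Rightarrow> ext_weyl \<Rightarrow> ext_weyl" where
  "minus_ext_weyl x y = x + (- y)"

instance
proof
  fix x y z :: ext_weyl
  show "x + y + z = x + (y + z)"
    by transfer (auto simp: comp_assoc weyl_add weyl_inv o_inv_distrib weyl_bij add.assoc)
  show "0 + x = x"
    by transfer (auto simp: weyl_zero weyl_inv)
  show "x + 0 = x"
    by transfer auto
  show "- x + x = 0"
    by transfer (auto simp: weyl_uminus weyl_inv weyl_bij bij_is_inj zero_prod_def)
  show "x + - y = x - y"
    by (simp add: minus_ext_weyl_def)
qed

end

lemma ext_weyl_eqI:
  "fin_part x = fin_part y \<Longrightarrow> trans_part x = trans_part y \<Longrightarrow> x = y"
  by transfer (auto intro: prod_eqI)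

lemma fin_part_weyl: "fin_part y \<in> weyl"
  by transfer auto

lemma fin_part_plus: "fin_part (x + y) = fin_part x \<circ> fin_part y"
  by transfer simp

lemma trans_part_plus:
  "trans_part (x + y) = inv_into UNIV (fin_part y) (trans_part x) + trans_part y"
  by transfer simp

lemma fin_part_uminus: "fin_part (- y) = inv_into UNIV (fin_part y)"
  by transfer simp

lemma trans_part_uminus: "trans_part (- y) = - fin_part y (trans_part y)"
  by transfer simp

lemma fin_part_transl: "fin_part (transl b) = id"
  by transfer simp

lemma trans_part_transl: "trans_part (transl b) = b"
  by transfer simp

text \<open>The defining relation \<open>w t_b w^{-1} = t_{w(b)}\<close> of the semidirect product.\<close>

lemma transl_conj:
  assumes "trans_part y = 0"
  shows "y + transl b + (- y) = transl (fin_part y b)"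
proof (rule ext_weyl_eqI)
  have w: "fin_part y \<in> weyl" "bij (fin_part y)"
    using fin_part_weyl weyl_bij by blast+
  show "fin_part (y + transl b + - y) = fin_part (transl (fin_part y b))"
    using surj_iff[of "fin_part y"] bij_is_surj[OF w(2)]
    by (simp only: fin_part_plus fin_part_uminus fin_part_transl comp_id simp_thms)
  show "trans_part (y + transl b + - y) = trans_part (transl (fin_part y b))"
    using w assms
    by (simp add: trans_part_plus trans_part_uminus trans_part_transl fin_part_uminus
        fin_part_transl inv_inv_eq weyl_zero weyl_inv del: add_uminus_conv_diff)
qed

definition affine_weyl :: "ext_weyl set" where
  "affine_weyl = {y. trans_part y \<in> root_lattice}"

text \<open>In the notation \<open>y = w t_{-l}\<close>, the weight \<open>l\<close> is \<open>- trans_part y\<close>.\<close>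

definition iota :: "ext_weyl \<Rightarrow> weight" where
  "iota y = smul 3 (- trans_part y) + dot (inv_into UNIV (fin_part y)) 0"

definition W_plus :: "ext_weyl set" where
  "W_plus = {y. - trans_part y \<in> dominant
     \<and> (fin_part y alpha1 \<in> negative_roots \<longrightarrow> 0 < fst (- trans_part y))
     \<and> (fin_part y alpha2 \<in> negative_roots \<longrightarrow> 0 < snd (- trans_part y))}"


section \<open>Irreducible sl(3)-modules and weight multiplicities\<close>

definition sl3 :: "(complex^3^3) set" where
  "sl3 = {A. trace A = 0}"

definition bracket :: "complex^3^3 \<Rightarrow> complex^3^3 \<Rightarrow> complex^3^3" where
  "bracket A B = A ** B - B ** A"

definition cartan :: "(complex^3^3) set" where
  "cartan = {H \<in> sl3. \<forall>i j. i \<noteq> j \<longrightarrow> H $ i $ j = 0}"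

definition unit_matrix :: "3 \<Rightarrow> 3 \<Rightarrow> complex^3^3" where
  "unit_matrix i j = (\<chi> k l. if k = i \<and> l = j then 1 else 0)"

text \<open>The fundamental weights send \<open>diag(h1, h2, h3)\<close> to \<open>h1\<close> and \<open>h1 + h2\<close>; the positive root
  vectors are then the matrix units above the diagonal.\<close>

definition weight_eval :: "weight \<Rightarrow> complex^3^3 \<Rightarrow> complex" where
  "weight_eval l H = of_int (fst l) * H $ 1 $ 1 + of_int (snd l) * (H $ 1 $ 1 + H $ 2 $ 2)"

locale sl3_module = vector_space scale
  for scale :: "complex \<Rightarrow> 'v::ab_group_add \<Rightarrow> 'v" +
  fixes V :: "'v set" and act :: "complex^3^3 \<Rightarrow> 'v \<Rightarrow> 'v"
  assumes subspace_V: "subspace V"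
    and act_closed: "A \<in> sl3 \<Longrightarrow> v \<in> V \<Longrightarrow> act A v \<in> V"
    and act_add: "A \<in> sl3 \<Longrightarrow> v \<in> V \<Longrightarrow> v' \<in> V \<Longrightarrow> act A (v + v') = act A v + act A v'"
    and act_scale: "A \<in> sl3 \<Longrightarrow> v \<in> V \<Longrightarrow> act A (scale c v) = scale c (act A v)"
    and add_act: "A \<in> sl3 \<Longrightarrow> B \<in> sl3 \<Longrightarrow> v \<in> V \<Longrightarrow> act (A + B) v = act A v + act B v"
    and scale_act: "A \<in> sl3 \<Longrightarrow> v \<in> V \<Longrightarrow> act (\<chi> i j. c * A $ i $ j) v = scale c (act A v)"
    and bracket_act: "A \<in> sl3 \<Longrightarrow> B \<in> sl3 \<Longrightarrow> v \<in> V \<Longrightarrow>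
      act (bracket A B) v = act A (act B v) - act B (act A v)"
begin

definition submodule :: "'v set \<Rightarrow> bool" where
  "submodule U \<longleftrightarrow> subspace U \<and> U \<subseteq> V \<and> (\<forall>A\<in>sl3. \<forall>u\<in>U. act A u \<in> U)"

definition irreducible_module :: bool where
  "irreducible_module \<longleftrightarrow> V \<noteq> {0} \<and> (\<forall>U. submodule U \<longrightarrow> U = {0} \<or> U = V)"

definition weight_space :: "weight \<Rightarrow> 'v set" where
  "weight_space m = {v \<in> V. \<forall>H\<in>cartan. act H v = scale (weight_eval m H) v}"

definition has_highest_weight :: "weight \<Rightarrow> bool" where
  "has_highest_weight l \<longleftrightarrow> (\<exists>v\<in>weight_space l. v \<noteq> 0 \<and>
     act (unit_matrix 1 2) v = 0 \<and> act (unit_matrix 2 3) v = 0 \<and> act (unit_matrix 1 3) v = 0)"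

definition multiplicity :: "weight \<Rightarrow> nat" where
  "multiplicity m = dim (weight_space m)"

end

text \<open>The multiplicity of the weight \<open>m\<close> in the irreducible module of highest weight \<open>l\<close>.
  The quantifier over modules needs some fixed ambient vector space; the choice of the
  polynomials in one variable is immaterial, since an irreducible highest weight module has
  countable dimension and so is isomorphic to one whose carrier is a subspace of that space.\<close>

definition weight_mult :: "weight \<Rightarrow> weight \<Rightarrow> nat" where
  "weight_mult l m = (THE n. \<exists>(V :: complex poly set) act.
     sl3_module Polynomial.smult V act \<and>
     sl3_module.irreducible_module Polynomial.smult V act \<and>
     sl3_module.has_highest_weight Polynomial.smult V act l \<and>
     n = sl3_module.multiplicity Polynomial.smult V act m)"


section \<open>The characters and the ring they generate\<close>

definition orbit :: "ext_weyl \<Rightarrow> ext_weyl set" where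
  "orbit y = {u + y | u. u \<in> affine_weyl}"

text \<open>The sum is restricted to the nonzero terms, of which there are finitely many.\<close>

definition chi :: "ext_weyl \<Rightarrow> (ext_weyl \<Rightarrow>\<^sub>0 int)" where
  "chi y = (\<Sum>z \<in> {z \<in> orbit y. weight_mult (iota y) (iota z) \<noteq> 0}.
     Poly_Mapping.single z (int (weight_mult (iota y) (iota z))))"

definition group_ring :: "(ext_weyl \<Rightarrow>\<^sub>0 int) ring" where
  "group_ring = \<lparr>carrier = UNIV, monoid.mult = (*), one = 1, ring.zero = 0, add = (+)\<rparr>"

definition character_ring :: "(ext_weyl \<Rightarrow>\<^sub>0 int) ring" where
  "character_ring = group_ring\<lparr>carrier := generate_ring group_ring {chi y | y. y \<in> W_plus}\<rparr>"

end

theory Submission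
  imports Defs
begin

text \<open>The map \<open>iota\<close> is a cocycle, \<open>\<iota>(x y) = v \<iota>(x) + \<iota>(y)\<close> with \<open>v\<close> the inverse of the finite part of
\<open>y\<close> (the group is written additively in the formal text), and it maps every coset of the affine
Weyl group bijectively onto the same set, the honeycomb: the root lattice \<open>Q\<close> without one of the
three classes of \<open>Q\<close> modulo \<open>3P\<close>. Since weight multiplicities are invariant under the finite
Weyl group, the coefficient of the product of the characters of \<open>y\<close> and \<open>y'\<close> at an element \<open>x\<close>
of the right coset is the sum of \<open>m(\<iota>(x) - \<nu>) m'(\<nu>)\<close> over all \<open>\<nu>\<close> in the honeycomb, where \<open>m\<close>,
\<open>m'\<close> are the multiplicity functions with highest weights \<open>\<iota>(y)\<close>, \<open>\<iota>(y')\<close>. This is an ordinary,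
commutative convolution on the weight lattice, truncated to the honeycomb in one factor.

Let \<open>z\<close>, \<open>a\<close>, \<open>b\<close> be the parts of \<open>m\<close>, seen in the group ring of the weight lattice, that lie in
the classes of \<open>0\<close>, \<open>\<rho>\<close>, \<open>-\<rho>\<close>, so that \<open>m = z + a + b\<close> and the honeycomb part is \<open>z + a\<close>. Then
\<open>m (z' + a') - m' (z + a) = (b z' - b' z) + (b a' - b' a)\<close>, and the first bracket lives in the
class of \<open>-\<rho>\<close>, which is not in the honeycomb. So the claim becomes \<open>b a' = b' a\<close>.

Here the representation theory enters. The Weyl denominator of sl(3) is \<open>A - B\<close>, with \<open>A\<close> and
\<open>B\<close> the sums of \<open>exp(w \<rho>)\<close> over the even and the odd \<open>w\<close>; \<open>A\<close> lies in the class of \<open>\<rho>\<close> and \<open>B\<close>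
in that of \<open>-\<rho>\<close>. The product of the denominator with the character of highest weight \<open>l\<close> is
supported on vectors of the same length as \<open>l + \<rho>\<close> (\<open>denominator_multiplicity_eigen\<close>). In the
normalisation \<open>qnorm\<close>, the squared length of a vector of \<open>3P\<close> is divisible by 9, while that of
\<open>\<iota>(y) + \<rho>\<close> is 3 modulo 9. Therefore the part of \<open>(A - B) m\<close> in \<open>3P\<close> vanishes, which says \<open>A b =
B a\<close>; likewise \<open>A b' = B a'\<close>. Hence \<open>A b a' = B a a' = A b' a\<close>, and \<open>A\<close> cancels
(\<open>honeycomb_convolution_commute\<close>).

The properties of \<open>m\<close> are derived for an arbitrary irreducible module with a dominant highest
weight. The module is spanned by the vectors obtained from the highest weight vector by the two
lowering operators. The identity for the denominator is the trace of the Casimir operator on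
each weight space (Freudenthal's argument). The Weyl group symmetry follows from sl(2) theory
for the two simple roots. Finally, two modules with the same highest weight have the same
multiplicities: their difference would have a dominant weight of maximal height in its support,
and the identity for the denominator excludes that (\<open>multiplicity_unique\<close>). For a highest weight
that belongs to no module in the ambient space the character is zero (\<open>chi_constant_zero\<close>).\<close>

section \<open>The action of the Chevalley generators\<close>

text \<open>The two simple roots are indexed by \<open>bool\<close>, with \<open>True\<close> for the first, so that statements
symmetric under the exchange of the two nodes of the Dynkin diagram are made and proved once,
and \<open>\<not> i\<close> is the other node.\<close>

definition coord :: "bool \<Rightarrow> weight \<Rightarrow> int" where
  "coord i m = (if i then fst m else snd m)"

definition sroot :: "bool \<Rightarrow> weight" where
  "sroot i = (if i then alpha1 else alpha2)"

lemma coord_sroot: "coord i (sroot j) = (if i = j then 2 else -1)"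
  by (auto simp: coord_def sroot_def alpha1_def alpha2_def)

lemma coord_add: "coord i (m + n) = coord i m + coord i n"
  and coord_diff: "coord i (m - n) = coord i m - coord i n"
  by (auto simp: coord_def)

lemma unit_matrix_mult:
  "unit_matrix i j ** unit_matrix k l = (if j = k then unit_matrix i l else 0)"
proof -
  have "(\<Sum>a\<in>UNIV. (if b = i \<and> a = j then 1 else 0) * (if a = k \<and> c = l then 1 else (0::complex)))
     = (\<Sum>a\<in>UNIV. if a = j then (if b = i \<and> j = k \<and> c = l then 1 else 0) else 0)" for b c
    by (rule sum.cong) auto
  then show ?thesis
    by (simp add: vec_eq_iff matrix_matrix_mult_def unit_matrix_def)
qed

lemma bracket_unit:
  "bracket (unit_matrix i j) (unit_matrix k l) =
     (if j = k then unit_matrix i l else 0) - (if l = i then unit_matrix k j else 0)"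
  by (auto simp: bracket_def unit_matrix_mult)

definition raise_mat :: "bool \<Rightarrow> complex^3^3" where
  "raise_mat i = (if i then unit_matrix 1 2 else unit_matrix 2 3)"
definition lower_mat :: "bool \<Rightarrow> complex^3^3" where
  "lower_mat i = (if i then unit_matrix 2 1 else unit_matrix 3 2)"
definition coroot :: "bool \<Rightarrow> complex^3^3" where
  "coroot i = (if i then unit_matrix 1 1 - unit_matrix 2 2 else unit_matrix 2 2 - unit_matrix 3 3)"

lemma unit_matrix_sl3: "i \<noteq> j \<Longrightarrow> unit_matrix i j \<in> sl3"
  by (auto simp: sl3_def trace_def unit_matrix_def intro!: sum.neutral)

lemma raise_sl3: "raise_mat i \<in> sl3" and lower_sl3: "lower_mat i \<in> sl3"
  by (auto simp: raise_mat_def lower_mat_def intro!: unit_matrix_sl3)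

lemma coroot_sl3: "coroot i \<in> sl3"
  by (auto simp: sl3_def trace_def unit_matrix_def coroot_def sum_subtractf)

lemma coroot_cartan: "coroot i \<in> cartan"
  using coroot_sl3[of i] by (auto simp: cartan_def coroot_def unit_matrix_def)

lemma sl3_add: "A \<in> sl3 \<Longrightarrow> B \<in> sl3 \<Longrightarrow> A + B \<in> sl3"
  by (simp add: sl3_def trace_def sum.distrib)

definition mscale :: "complex \<Rightarrow> complex^3^3 \<Rightarrow> complex^3^3" where
  "mscale c A = (\<chi> i j. c * A $ i $ j)"

lemma mscale_sl3: "A \<in> sl3 \<Longrightarrow> mscale c A \<in> sl3"
  by (simp add: sl3_def trace_def mscale_def sum_distrib_left[symmetric])

lemma sl3_zero: "0 \<in> sl3"
  by (simp add: sl3_def trace_def)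

lemma sl3_diff: "A \<in> sl3 \<Longrightarrow> B \<in> sl3 \<Longrightarrow> A - B \<in> sl3"
  by (simp add: sl3_def trace_def sum_subtractf)

lemma sl3_decomposition:
  assumes "A \<in> sl3"
  shows "A = mscale (A $ 1 $ 1) (coroot True) + mscale (A $ 1 $ 1 + A $ 2 $ 2) (coroot False)
    + mscale (A $ 1 $ 2) (raise_mat True) + mscale (A $ 2 $ 3) (raise_mat False)
    + mscale (A $ 1 $ 3) (unit_matrix 1 3)
    + mscale (A $ 2 $ 1) (lower_mat True) + mscale (A $ 3 $ 2) (lower_mat False)
    + mscale (A $ 3 $ 1) (unit_matrix 3 1)"
proof -
  have "A $ 1 $ 1 + A $ 2 $ 2 + A $ 3 $ 3 = 0"
    using assms by (simp add: sl3_def trace_def sum_3)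
  then have "A $ 3 $ 3 = - (A $ 1 $ 1 + A $ 2 $ 2)"
    by (simp add: eq_neg_iff_add_eq_0 algebra_simps)
  then show ?thesis
    by (simp add: vec_eq_iff forall_3 mscale_def coroot_def raise_mat_def lower_mat_def unit_matrix_def)
qed

lemma cartan_decomposition:
  assumes "A \<in> cartan"
  shows "A = mscale (A $ 1 $ 1) (coroot True) + mscale (A $ 1 $ 1 + A $ 2 $ 2) (coroot False)"
proof -
  have "A $ 1 $ 1 + A $ 2 $ 2 + A $ 3 $ 3 = 0"
    using assms by (simp add: cartan_def sl3_def trace_def sum_3)
  then have "A $ 3 $ 3 = - (A $ 1 $ 1 + A $ 2 $ 2)"
    by (simp add: eq_neg_iff_add_eq_0 algebra_simps)
  moreover have "\<forall>i j. i \<noteq> j \<longrightarrow> A $ i $ j = 0"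
    using assms by (simp add: cartan_def)
  ultimately show ?thesis
    by (simp add: vec_eq_iff forall_3 mscale_def coroot_def unit_matrix_def)
qed

context sl3_module
begin

text \<open>\<open>E3\<close> and \<open>F3\<close> belong to the highest root. They are commutators of the simple root
vectors.\<close>

definition E :: "bool \<Rightarrow> 'v \<Rightarrow> 'v" where "E i = act (raise_mat i)"
definition F :: "bool \<Rightarrow> 'v \<Rightarrow> 'v" where "F i = act (lower_mat i)"
definition H :: "bool \<Rightarrow> 'v \<Rightarrow> 'v" where "H i = act (coroot i)"
definition E3 :: "'v \<Rightarrow> 'v" where "E3 = act (unit_matrix 1 3)"
definition F3 :: "'v \<Rightarrow> 'v" where "F3 = act (unit_matrix 3 1)"

text \<open>The module axioms constrain the operators only on \<open>V\<close>, so linearity is relative to \<open>V\<close>.\<close>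

definition linear_on_V :: "('v \<Rightarrow> 'v) \<Rightarrow> bool" where
  "linear_on_V g \<longleftrightarrow> (\<forall>x\<in>V. g x \<in> V) \<and> (\<forall>x\<in>V. \<forall>y\<in>V. g (x + y) = g x + g y)
     \<and> (\<forall>c. \<forall>x\<in>V. g (scale c x) = scale c (g x))"

lemma linear_on_V_act: "A \<in> sl3 \<Longrightarrow> linear_on_V (act A)"
  by (simp add: linear_on_V_def act_closed act_add act_scale)

lemma linear_E: "linear_on_V (E i)" and linear_F: "linear_on_V (F i)" and linear_H: "linear_on_V (H i)"
  and linear_E3: "linear_on_V E3" and linear_F3: "linear_on_V F3"
  by (simp_all add: E_def F_def H_def E3_def F3_def linear_on_V_act raise_sl3 lower_sl3 coroot_sl3
      unit_matrix_sl3)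

lemmas linear_ops = linear_E linear_F linear_H linear_E3 linear_F3

lemma linear_on_V_closed: "linear_on_V g \<Longrightarrow> x \<in> V \<Longrightarrow> g x \<in> V"
  and linear_on_V_add: "linear_on_V g \<Longrightarrow> x \<in> V \<Longrightarrow> y \<in> V \<Longrightarrow> g (x + y) = g x + g y"
  and linear_on_V_scale: "linear_on_V g \<Longrightarrow> x \<in> V \<Longrightarrow> g (scale c x) = scale c (g x)"
  by (simp_all add: linear_on_V_def)

lemmas V_closed [simp, intro] = linear_ops[THEN linear_on_V_closed]
lemmas op_add = linear_ops[THEN linear_on_V_add]
lemmas op_scale = linear_ops[THEN linear_on_V_scale]

lemmas V_ops [simp, intro] = subspace_0[OF subspace_V] subspace_add[OF subspace_V]
  subspace_diff[OF subspace_V] subspace_scale[OF subspace_V] subspace_neg[OF subspace_V]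

lemma linear_on_V_0: "linear_on_V g \<Longrightarrow> g 0 = 0"
  using linear_on_V_scale[of g 0 0] by simp

lemma linear_on_V_neg: "linear_on_V g \<Longrightarrow> x \<in> V \<Longrightarrow> g (- x) = - g x"
  using linear_on_V_scale[of g x "-1"] by simp

lemma linear_on_V_diff: "linear_on_V g \<Longrightarrow> x \<in> V \<Longrightarrow> y \<in> V \<Longrightarrow> g (x - y) = g x - g y"
  using linear_on_V_add[of g x "- y"] linear_on_V_neg[of g y] by simp

lemmas op_diff = linear_ops[THEN linear_on_V_diff]
lemmas op_0 [simp] = linear_ops[THEN linear_on_V_0]

lemma linear_on_V_sum:
  "linear_on_V g \<Longrightarrow> (\<And>a. a \<in> S \<Longrightarrow> u a \<in> V) \<Longrightarrow> g (\<Sum>a\<in>S. u a) = (\<Sum>a\<in>S. g (u a))"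
proof (induction S rule: infinite_finite_induct)
  case (insert a S)
  then show ?case
    using linear_on_V_add[of g "u a" "sum u S"] subspace_sum[OF subspace_V, of S u] by simp
qed (simp_all add: linear_on_V_0)

lemma linear_on_V_span:
  assumes "linear_on_V g" "S \<subseteq> V" "\<And>s. s \<in> S \<Longrightarrow> g s \<in> span T" "x \<in> span S"
  shows "g x \<in> span T"
proof -
  have "x \<in> V \<and> g x \<in> span T"
    using assms(4)
  proof (induction rule: span_induct_alt)
    case base
    then show ?case using linear_on_V_0[OF assms(1)] span_zero by simp
  next
    case (step c x y)
    then have "x \<in> V" using assms(2) by blast
    then show ?case using step assms(3)[of x]
      by (auto simp: linear_on_V_add[OF assms(1)] linear_on_V_scale[OF assms(1)]
          intro!: span_add span_scale)
  qed
  then show ?thesis by blast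
qed

lemma act_zero: "v \<in> V \<Longrightarrow> act 0 v = 0"
  using add_act[OF sl3_zero sl3_zero] by simp

lemma act_diff: "A \<in> sl3 \<Longrightarrow> B \<in> sl3 \<Longrightarrow> v \<in> V \<Longrightarrow> act (A - B) v = act A v - act B v"
  using add_act[of "A - B" B v] sl3_diff[of A B] by (simp add: algebra_simps)

lemma act_mscale: "A \<in> sl3 \<Longrightarrow> v \<in> V \<Longrightarrow> act (mscale c A) v = scale c (act A v)"
  using scale_act by (simp add: mscale_def)

lemma act_commute:
  assumes "A \<in> sl3" "B \<in> sl3" "x \<in> V" "bracket A B = C"
  shows "act A (act B x) = act B (act A x) + act C x"
  using bracket_act[OF assms(1-3)] assms(4) by (simp add: algebra_simps)

lemma E_F: "x \<in> V \<Longrightarrow> E i (F j x) = F j (E i x) + (if i = j then H i x else 0)"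
proof -
  assume x: "x \<in> V"
  have "bracket (raise_mat i) (lower_mat j) = (if i = j then coroot i else 0)"
    by (cases i; cases j) (auto simp: raise_mat_def lower_mat_def coroot_def bracket_unit)
  from act_commute[OF raise_sl3 lower_sl3 x this] show ?thesis
    using x by (auto simp: E_def F_def H_def act_zero)
qed

lemma H_F: "x \<in> V \<Longrightarrow> H i (F j x) = F j (H i x) - scale (of_int (coord i (sroot j))) (F j x)"
proof -
  assume x: "x \<in> V"
  have "bracket (coroot i) (lower_mat j) = mscale (- of_int (coord i (sroot j))) (lower_mat j)"
    by (cases i; cases j)
      (auto simp: vec_eq_iff forall_3 bracket_def matrix_matrix_mult_def sum_3 lower_mat_def
         coroot_def coord_sroot mscale_def unit_matrix_def)
  from act_commute[OF coroot_sl3 lower_sl3 x this] show ?thesis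
    using x by (simp add: F_def H_def act_mscale lower_sl3)
qed

lemma H_E: "x \<in> V \<Longrightarrow> H i (E j x) = E j (H i x) + scale (of_int (coord i (sroot j))) (E j x)"
proof -
  assume x: "x \<in> V"
  have "bracket (coroot i) (raise_mat j) = mscale (of_int (coord i (sroot j))) (raise_mat j)"
    by (cases i; cases j)
      (auto simp: vec_eq_iff forall_3 bracket_def matrix_matrix_mult_def sum_3 raise_mat_def
         coroot_def coord_sroot mscale_def unit_matrix_def)
  from act_commute[OF coroot_sl3 raise_sl3 x this] show ?thesis
    using x by (simp add: E_def H_def act_mscale raise_sl3)
qed

lemma F3_eq: "x \<in> V \<Longrightarrow> F3 x = F False (F True x) - F True (F False x)"
  and E3_eq: "x \<in> V \<Longrightarrow> E3 x = E True (E False x) - E False (E True x)"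
proof -
  assume x: "x \<in> V"
  have "bracket (lower_mat False) (lower_mat True) = unit_matrix 3 1"
    "bracket (raise_mat True) (raise_mat False) = unit_matrix 1 3"
    by (simp_all add: raise_mat_def lower_mat_def bracket_unit)
  from act_commute[OF lower_sl3 lower_sl3 x this(1)] act_commute[OF raise_sl3 raise_sl3 x this(2)]
  show "F3 x = F False (F True x) - F True (F False x)"
    "E3 x = E True (E False x) - E False (E True x)"
    by (simp_all add: E_def F_def E3_def F3_def)
qed

lemma F_F3: "x \<in> V \<Longrightarrow> F i (F3 x) = F3 (F i x)"
proof -
  assume x: "x \<in> V"
  have "bracket (lower_mat i) (unit_matrix 3 1) = 0"
    by (cases i) (simp_all add: lower_mat_def bracket_unit)
  from act_commute[OF lower_sl3 unit_matrix_sl3 x this] show ?thesis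
    using x by (simp add: F_def F3_def act_zero)
qed

lemma E3_F: "x \<in> V \<Longrightarrow> E3 (F i x) = F i (E3 x) + (if i then - E False x else E True x)"
proof -
  assume x: "x \<in> V"
  have "bracket (unit_matrix 1 3) (lower_mat i) = (if i then 0 - raise_mat False else raise_mat True)"
    by (cases i) (simp_all add: lower_mat_def raise_mat_def bracket_unit)
  from act_commute[OF unit_matrix_sl3 lower_sl3 x this] show ?thesis
    using x act_diff[OF sl3_zero raise_sl3 x] by (auto simp: E_def F_def E3_def act_zero)
qed

lemma E3_F3: "x \<in> V \<Longrightarrow> E3 (F3 x) = F3 (E3 x) + (H True x + H False x)"
proof -
  assume x: "x \<in> V"
  have "bracket (unit_matrix 1 3) (unit_matrix 3 1) = coroot True + coroot False"
    by (simp add: coroot_def bracket_unit)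
  from act_commute[OF unit_matrix_sl3 unit_matrix_sl3 x this] show ?thesis
    using x add_act[OF coroot_sl3 coroot_sl3 x] by (simp add: E3_def F3_def H_def)
qed

lemma act_decomposition:
  assumes A: "A \<in> sl3" and x: "x \<in> V"
  shows "act A x = scale (A $ 1 $ 1) (H True x) + scale (A $ 1 $ 1 + A $ 2 $ 2) (H False x)
    + scale (A $ 1 $ 2) (E True x) + scale (A $ 2 $ 3) (E False x) + scale (A $ 1 $ 3) (E3 x)
    + scale (A $ 2 $ 1) (F True x) + scale (A $ 3 $ 2) (F False x) + scale (A $ 3 $ 1) (F3 x)"
  by (subst sl3_decomposition[OF A])
    (simp add: x add_act sl3_add mscale_sl3 raise_sl3 lower_sl3 coroot_sl3 unit_matrix_sl3
      act_mscale E_def F_def H_def E3_def F3_def)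

text \<open>The simple root vectors generate sl(3): \<open>H\<close>, \<open>E3\<close> and \<open>F3\<close> act through commutators of
them.\<close>

lemma submoduleI:
  assumes U: "subspace U" "U \<subseteq> V" and EF: "\<And>i x. x \<in> U \<Longrightarrow> E i x \<in> U" "\<And>i x. x \<in> U \<Longrightarrow> F i x \<in> U"
  shows "submodule U"
proof -
  have "H i x \<in> U" if "x \<in> U" for i x
  proof -
    have "H i x = E i (F i x) - F i (E i x)"
      using E_F[of x i i] that U by auto
    then show ?thesis using that EF subspace_diff[OF U(1)] by simp
  qed
  note H = this
  have "E3 x \<in> U" "F3 x \<in> U" if "x \<in> U" for x
    using that E3_eq[of x] F3_eq[of x] EF subspace_diff[OF U(1)] U by auto
  note H3 = H this
  have "act A x \<in> U" if "A \<in> sl3" "x \<in> U" for A x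
  proof -
    have "x \<in> V" using that U(2) by blast
    then show ?thesis
      unfolding act_decomposition[OF that(1) \<open>x \<in> V\<close>]
      by (intro subspace_add[OF U(1)] subspace_scale[OF U(1)]) (use that EF H3 in simp_all)
  qed
  then show ?thesis
    using U by (simp add: submodule_def)
qed

lemma weight_space_iff:
  "x \<in> weight_space m \<longleftrightarrow> x \<in> V \<and> (\<forall>i. H i x = scale (of_int (coord i m)) x)"
proof (intro iffI conjI allI)
  assume x: "x \<in> weight_space m"
  then show "x \<in> V" by (simp add: weight_space_def)
  fix i
  have "weight_eval m (coroot i) = of_int (coord i m)"
    by (simp add: weight_eval_def coroot_def coord_def unit_matrix_def)
  then show "H i x = scale (of_int (coord i m)) x"
    using x coroot_cartan[of i] by (simp add: weight_space_def H_def)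
next
  assume x: "x \<in> V \<and> (\<forall>i. H i x = scale (of_int (coord i m)) x)"
  have "act A x = scale (weight_eval m A) x" if "A \<in> cartan" for A
    using x by (subst cartan_decomposition[OF that])
      (simp add: add_act mscale_sl3 coroot_sl3 act_mscale flip: H_def,
       simp add: weight_eval_def coord_def algebra_simps)
  then show "x \<in> weight_space m"
    using x by (simp add: weight_space_def)
qed

lemma weight_space_V: "x \<in> weight_space m \<Longrightarrow> x \<in> V"
  by (simp add: weight_space_iff)

lemma H_weight: "x \<in> weight_space m \<Longrightarrow> H i x = scale (of_int (coord i m)) x"
  by (simp add: weight_space_iff)

lemma F_weight: "x \<in> weight_space m \<Longrightarrow> F i x \<in> weight_space (m - sroot i)"
  by (simp add: weight_space_iff H_F op_scale coord_diff scale_left_diff_distrib)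

lemma E_weight: "x \<in> weight_space m \<Longrightarrow> E i x \<in> weight_space (m + sroot i)"
  by (simp add: weight_space_iff H_E op_scale coord_add scale_left_distrib)

lemma subspace_weight_space: "subspace (weight_space m)"
  by (rule subspaceI) (auto simp: weight_space_iff op_add op_scale algebra_simps)

end

section \<open>Modules spanned by words in the lowering operators\<close>

definition height :: "weight \<Rightarrow> int" where
  "height m = fst m + snd m"

lemma height_add: "height (m + n) = height m + height n"
  and height_diff: "height (m - n) = height m - height n"
  and height_sroot: "height (sroot i) = 1"
  by (auto simp: height_def sroot_def alpha1_def alpha2_def)

text \<open>The amount by which a word in the two lowering operators lowers the weight. Each letter
lowers the height by one, so that only finitely many words lead to a given weight.\<close>

fun word_weight :: "bool list \<Rightarrow> weight" where
  "word_weight [] = 0"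
| "word_weight (i # is) = sroot i + word_weight is"

lemma height_word_weight: "height (word_weight is) = int (length is)"
  by (induction "is") (auto simp: height_add height_sroot, simp add: height_def)

lemma finite_words: "finite {is. word_weight is = k}"
proof (rule finite_subset)
  show "{is. word_weight is = k} \<subseteq> {is. set is \<subseteq> UNIV \<and> length is = nat (height k)}"
    using height_word_weight by auto
  show "finite {is. set is \<subseteq> (UNIV::bool set) \<and> length is = nat (height k)}"
    by (rule finite_lists_length_eq) simp
qed

lemma word_weight_eq: "\<exists>a b::nat. word_weight is = (2 * int a - int b, 2 * int b - int a)"
proof (induction "is")
  case Nil
  show ?case by (rule exI[of _ 0], rule exI[of _ 0]) (simp add: zero_prod_def)
next
  case (Cons i "is")
  then obtain a b :: nat where "word_weight is = (2 * int a - int b, 2 * int b - int a)" by blast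
  then show ?case
    by (intro exI[of _ "if i then a + 1 else a"] exI[of _ "if i then b else b + 1"])
      (auto simp: sroot_def alpha1_def alpha2_def)
qed

context sl3_module
begin

text \<open>Independence of eigenvectors: subtracting the eigenvalue of the new index from \<open>g\<close> removes
one summand and rescales the others by nonzero factors.\<close>

lemma sum_eigenvectors_zero:
  assumes "finite S" "linear_on_V g" "\<And>a. a \<in> S \<Longrightarrow> u a \<in> V"
    "\<And>a. a \<in> S \<Longrightarrow> g (u a) = scale (c a) (u a)" "inj_on c S" "(\<Sum>a\<in>S. u a) = 0" "a \<in> S"
  shows "u a = 0"
  using assms
proof (induction S arbitrary: u a rule: finite_induct)
  case (insert b S)
  \<comment> \<open>The summands of \<open>g (\<Sum>u) - c b (\<Sum>u)\<close>; the one with index \<open>b\<close> is zero.\<close>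
  define w where "w a = scale (c a - c b) (u a)" for a
  have "(\<Sum>a\<in>insert b S. w a) = (\<Sum>a\<in>insert b S. g (u a)) - scale (c b) (\<Sum>a\<in>insert b S. u a)"
    unfolding scale_sum_right sum_subtractf[symmetric]
    by (rule sum.cong) (simp_all add: w_def insert.prems scale_left_diff_distrib)
  also have "\<dots> = g (\<Sum>a\<in>insert b S. u a) - scale (c b) (\<Sum>a\<in>insert b S. u a)"
    by (subst linear_on_V_sum) (use insert.prems in auto)
  also have "\<dots> = 0"
    unfolding insert.prems(5) using linear_on_V_0[OF insert.prems(1)] by simp
  finally have "(\<Sum>a\<in>S. w a) = 0"
    using insert.hyps by (simp add: w_def)
  moreover have "g (w a) = scale (c a) (w a)" if "a \<in> S" for a
    using that insert.prems by (simp add: w_def linear_on_V_scale mult.commute)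
  ultimately have "w a = 0" if "a \<in> S" for a
    using insert.IH[of w a] insert.prems that by (auto simp: w_def)
  moreover have "c a \<noteq> c b" if "a \<in> S" for a
    using insert.prems(4) insert.hyps that by (auto simp: inj_on_def)
  ultimately have *: "u a = 0" if "a \<in> S" for a
    using that by (auto simp: w_def)
  then have "(\<Sum>a\<in>S. u a) = 0" by simp
  then have "u b = 0" using insert.prems(5) insert.hyps by simp
  then show ?case using * insert.prems(6) by auto
qed simp

text \<open>A weight is a pair of integers, so the single operator \<open>H\<^sub>1 + \<i> H\<^sub>2\<close> separates all
weights.\<close>

lemma sum_weight_vectors_zero:
  assumes "finite S" "\<And>m. m \<in> S \<Longrightarrow> u m \<in> weight_space m" "(\<Sum>m\<in>S. u m) = 0" "m \<in> S"
  shows "u m = 0"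
proof (rule sum_eigenvectors_zero[of S "\<lambda>x. H True x + scale \<i> (H False x)" u
      "\<lambda>m. of_int (fst m) + \<i> * of_int (snd m)"])
  show "linear_on_V (\<lambda>x. H True x + scale \<i> (H False x))"
    by (auto simp: linear_on_V_def op_add op_scale algebra_simps)
  show "inj_on (\<lambda>m. complex_of_int (fst m) + \<i> * complex_of_int (snd m)) S"
    by (rule inj_onI) (simp add: complex_eq_iff prod_eq_iff)
  show "u k \<in> V" if "k \<in> S" for k
    using weight_space_V assms(2)[OF that] .
  show "H True (u k) + scale \<i> (H False (u k)) = scale (of_int (fst k) + \<i> * of_int (snd k)) (u k)"
    if "k \<in> S" for k
    using H_weight[OF assms(2)[OF that]] by (simp add: coord_def scale_left_distrib)
qed (use assms in auto)

fun word :: "'v \<Rightarrow> bool list \<Rightarrow> 'v" where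
  "word x [] = x"
| "word x (i # is) = F i (word x is)"

definition singular :: "weight \<Rightarrow> 'v \<Rightarrow> bool" where
  "singular m x \<longleftrightarrow> x \<in> weight_space m \<and> x \<noteq> 0 \<and> (\<forall>i. E i x = 0)"

lemma word_weight_space:
  "x \<in> weight_space m \<Longrightarrow> word x is \<in> weight_space (m - word_weight is)"
proof (induction "is")
  case (Cons i "is")
  then show ?case using F_weight[of "word x is" "m - word_weight is" i]
    by (simp add: diff_diff_eq add.commute)
qed simp

lemma word_V: "x \<in> V \<Longrightarrow> word x is \<in> V"
  by (induction "is") auto

text \<open>The span is closed under raising operators because \<open>E\<close> can be commuted to the right
through a word at the price of shorter words, until it kills the singular vector.\<close>

lemma submodule_span_words:
  assumes x: "singular m x"
  shows "submodule (span (range (word x)))"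
proof -
  have xm: "x \<in> weight_space m" and xV: "x \<in> V" and Ex: "E i x = 0" for i
    using x by (auto simp: singular_def weight_space_V)
  have V: "range (word x) \<subseteq> V" using word_V[OF xV] by blast
  have base: "word x is \<in> span (range (word x))" for "is" by (simp add: span_base)
  have F: "F i y \<in> span (range (word x))" if "y \<in> span (range (word x))" for i y
  proof (rule linear_on_V_span[OF linear_F V _ that])
    fix s assume "s \<in> range (word x)"
    then obtain "is" where "s = word x is" by blast
    then show "F i s \<in> span (range (word x))" using base[of "i # is"] by simp
  qed
  have "E i (word x is) \<in> span (range (word x))" for i "is"
  proof (induction "is")
    case Nil
    then show ?case by (simp add: Ex span_zero)
  next
    case (Cons j "is")
    have "H i (word x is) \<in> span (range (word x))"
      by (simp add: H_weight[OF word_weight_space[OF xm]] span_scale base)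
    then show ?case
      using E_F[OF word_V[OF xV], of i j "is"] F[OF Cons] by (auto intro: span_add)
  qed
  then have "E i y \<in> span (range (word x))" if "y \<in> span (range (word x))" for i y
    using linear_on_V_span[OF linear_E V _ that] by blast
  then show ?thesis
    using F V span_minimal[OF V subspace_V] by (intro submoduleI) auto
qed

lemma span_words:
  assumes "irreducible_module" "singular m x"
  shows "span (range (word x)) = V"
proof -
  have "word x [] \<in> span (range (word x))" by (rule span_base) (rule rangeI)
  then have "x \<in> span (range (word x))" by simp
  moreover have "x \<noteq> 0" using assms(2) by (simp add: singular_def)
  ultimately show ?thesis
    using assms(1) submodule_span_words[OF assms(2)] by (auto simp: irreducible_module_def)
qed

text \<open>A weight vector is a sum of words of various weights; by independence of the weight spaces
all contributions of a different weight cancel.\<close>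

lemma weight_space_words:
  assumes irr: "irreducible_module" and x: "singular m x"
  shows "weight_space n = span (word x ` {is. word_weight is = m - n})"
proof -
  define S where "S n = word x ` {is. word_weight is = m - n}" for n
  have xm: "x \<in> weight_space m" using x by (simp add: singular_def)
  have S: "span (S n) \<subseteq> weight_space n" for n
  proof (rule span_minimal[OF _ subspace_weight_space])
    show "S n \<subseteq> weight_space n"
      using word_weight_space[OF xm] by (auto simp: S_def) (metis diff_diff_eq2 add_diff_cancel_left')
  qed
  have "\<exists>T u. finite T \<and> (\<forall>n\<in>T. u n \<in> span (S n)) \<and> y = (\<Sum>n\<in>T. u n)"
    if "y \<in> span (range (word x))" for y
    using that
  proof (induction rule: span_induct_alt)
    case base
    then show ?case by (intro exI[of _ "{}"]) simp
  next
    case (step c w y)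
    then obtain T u where T: "finite T" "\<forall>n\<in>T. u n \<in> span (S n)" "y = (\<Sum>n\<in>T. u n)" by blast
    from step obtain "is" where w: "w = word x is" by blast
    define k where "k = m - word_weight is"
    have wk: "w \<in> span (S k)" unfolding w by (rule span_base) (auto simp: S_def k_def)
    define u' where "u' n = (if n \<in> T then u n else 0) + (if n = k then scale c w else 0)" for n
    have "(\<Sum>n\<in>insert k T. u' n) = (\<Sum>n\<in>insert k T. if n \<in> T then u n else 0) + scale c w"
      using T(1) by (simp add: u'_def sum.distrib)
    also have "(\<Sum>n\<in>insert k T. if n \<in> T then u n else 0) = y"
      unfolding T(3) using T(1) by (intro sum.mono_neutral_cong_right) auto
    finally have "scale c w + y = (\<Sum>n\<in>insert k T. u' n)" by (simp add: add.commute)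
    moreover have "\<forall>n\<in>insert k T. u' n \<in> span (S n)"
      using T(2) wk by (auto simp: u'_def intro!: span_add span_scale span_zero)
    ultimately show ?case using T(1) by (intro exI[of _ "insert k T"] exI[of _ u']) simp
  qed
  then have dec: "\<exists>T u. finite T \<and> (\<forall>n\<in>T. u n \<in> span (S n)) \<and> y = (\<Sum>n\<in>T. u n)" if "y \<in> V" for y
    using that span_words[OF irr x] by blast
  have "y \<in> span (S n)" if y: "y \<in> weight_space n" for y
  proof -
    obtain T u where T: "finite T" "\<forall>n\<in>T. u n \<in> span (S n)" "y = (\<Sum>n\<in>T. u n)"
      using dec[OF weight_space_V[OF y]] by blast
    define u' where "u' k = (if k \<in> T then u k else 0) - (if k = n then y else 0)" for k
    have "(\<Sum>k\<in>insert n T. u' k) = (\<Sum>k\<in>insert n T. if k \<in> T then u k else 0) - y"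
      using T(1) by (simp add: u'_def sum_subtractf)
    also have "(\<Sum>k\<in>insert n T. if k \<in> T then u k else 0) = y"
      unfolding T(3) using T(1) by (intro sum.mono_neutral_cong_right) auto
    finally have "(\<Sum>k\<in>insert n T. u' k) = 0" by simp
    moreover have "u' k \<in> weight_space k" if "k \<in> insert n T" for k
    proof -
      have "(if k \<in> T then u k else 0) \<in> weight_space k"
        using T(2) S[of k] subspace_0[OF subspace_weight_space] by (metis subsetD)
      moreover have "(if k = n then y else 0) \<in> weight_space k"
        using y subspace_0[OF subspace_weight_space] by metis
      ultimately show ?thesis
        unfolding u'_def by (rule subspace_diff[OF subspace_weight_space])
    qed
    ultimately have "u' n = 0"
      using sum_weight_vectors_zero[of "insert n T" u' n] T(1) by simp
    then have "y = (if n \<in> T then u n else 0)" by (simp add: u'_def)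
    then show ?thesis using T(2) span_zero by auto
  qed
  then have "weight_space n = span (S n)" using S by blast
  then show ?thesis by (simp add: S_def)
qed

lemma weight_space_support:
  assumes "irreducible_module" "singular m x" "y \<in> weight_space n" "y \<noteq> 0"
  shows "\<exists>is. word_weight is = m - n"
proof (rule ccontr)
  assume "\<not> ?thesis"
  then have "weight_space n = span {}"
    using weight_space_words[OF assms(1,2), of n] by simp
  then show False using assms(3,4) by simp
qed

end

section \<open>Weyl group symmetry of the multiplicities\<close>

definition reflection :: "bool \<Rightarrow> weight \<Rightarrow> weight" where
  "reflection i = (if i then s1 else s2)"

lemma reflection_eq: "reflection i m = m - smul (coord i m) (sroot i)"
  by (simp add: reflection_def coord_def sroot_def s1_def s2_def)

lemma reflection_reflection [simp]: "reflection i (reflection i m) = m"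
  by (cases m) (simp add: reflection_def s1_apply s2_apply)

context sl3_module
begin

lemma linear_on_V_funpow: "linear_on_V g \<Longrightarrow> linear_on_V (g ^^ n)"
  by (induction n) (auto simp: linear_on_V_def)

lemma sl2_weight_funpow:
  assumes f: "linear_on_V f" and hf: "\<And>x. x \<in> V \<Longrightarrow> h (f x) = f (h x) - scale 2 (f x)"
    and x: "x \<in> V" "h x = scale k x"
  shows "h ((f ^^ n) x) = scale (k - 2 * of_nat n) ((f ^^ n) x)"
proof (induction n)
  case (Suc n)
  have "(f ^^ n) x \<in> V" using linear_on_V_closed[OF linear_on_V_funpow[OF f] x(1)] .
  then have "h ((f ^^ Suc n) x) = scale (k - 2 * of_nat n) (f ((f ^^ n) x)) - scale 2 (f ((f ^^ n) x))"
    by (simp add: hf Suc linear_on_V_scale[OF f])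
  then show ?case by (simp add: scale_left_diff_distrib[symmetric])
qed (simp add: x)

text \<open>The case \<open>k = n\<close>, in which the last term vanishes, is what makes a lowered highest weight
vector singular and what drives the injectivity below.\<close>

lemma sl2_commutator:
  assumes e: "linear_on_V e" and f: "linear_on_V f"
    and ef: "\<And>x. x \<in> V \<Longrightarrow> e (f x) = f (e x) + h x"
    and hf: "\<And>x. x \<in> V \<Longrightarrow> h (f x) = f (h x) - scale 2 (f x)"
    and x: "x \<in> V" "h x = scale k x"
  shows "e ((f ^^ Suc n) x) = (f ^^ Suc n) (e x) + scale ((of_nat n + 1) * (k - of_nat n)) ((f ^^ n) x)"
proof (induction n)
  case 0
  then show ?case using ef x by simp
next
  case (Suc n)
  have V: "(f ^^ m) x \<in> V" "(f ^^ m) (e x) \<in> V" for m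
    using linear_on_V_closed[OF linear_on_V_funpow[OF f]] linear_on_V_closed[OF e] x(1) by auto
  have "e ((f ^^ Suc (Suc n)) x) = f (e ((f ^^ Suc n) x)) + h ((f ^^ Suc n) x)"
    using ef[OF V(1)[of "Suc n"]] by simp
  also have "f (e ((f ^^ Suc n) x)) = (f ^^ Suc (Suc n)) (e x)
      + scale ((of_nat n + 1) * (k - of_nat n)) ((f ^^ Suc n) x)"
    unfolding Suc using V[of "Suc n"] V[of n]
    by (simp add: linear_on_V_add[OF f] linear_on_V_scale[OF f])
  also have "h ((f ^^ Suc n) x) = scale (k - 2 * of_nat (Suc n)) ((f ^^ Suc n) x)"
    by (rule sl2_weight_funpow[of f h, OF f hf x])
  finally have "e ((f ^^ Suc (Suc n)) x) = (f ^^ Suc (Suc n)) (e x)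
      + scale ((of_nat n + 1) * (k - of_nat n) + (k - 2 * of_nat (Suc n))) ((f ^^ Suc n) x)"
    by (simp only: add.assoc scale_left_distrib)
  also have "(of_nat n + 1) * (k - of_nat n) + (k - 2 * of_nat (Suc n))
      = (of_nat (Suc n) + 1) * (k - of_nat (Suc n))"
    by (simp add: algebra_simps)
  finally show ?case .
qed

text \<open>For an sl(2)-triple, lowering from weight \<open>k\<close> to weight \<open>-k\<close> is injective on vectors that
are eventually killed by raising. Induction on the number of raising steps: if \<open>f\<^sup>k x = 0\<close>, then
\<open>e x\<close>, which has weight \<open>k + 2\<close>, is killed by \<open>f\<close> to the power \<open>k + 2\<close>, so it is zero by
induction. Then \<open>x\<close> is itself a highest weight vector, and applying \<open>e\<close> to \<open>f\<^sup>n x\<close> with \<open>n \<le> k\<close>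
gives back a nonzero multiple of the previous power.\<close>

lemma sl2_power_injective:
  assumes e: "linear_on_V e" and f: "linear_on_V f"
    and ef: "\<And>x. x \<in> V \<Longrightarrow> e (f x) = f (e x) + h x"
    and he: "\<And>x. x \<in> V \<Longrightarrow> h (e x) = e (h x) + scale 2 (e x)"
    and hf: "\<And>x. x \<in> V \<Longrightarrow> h (f x) = f (h x) - scale 2 (f x)"
    and "x \<in> V" "h x = scale (of_nat k) x" "(f ^^ k) x = 0" "(e ^^ j) x = 0"
  shows "x = 0"
  using assms(6-9)
proof (induction j arbitrary: x k)
  case (Suc j)
  note x = Suc.prems(1,2)
  note comm = sl2_commutator[of e f h, OF e f ef hf x]
  define y where "y = e x"
  have y: "y \<in> V" "h y = scale (of_nat (k + 2)) y"
    using linear_on_V_closed[OF e] he x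
    by (simp_all add: y_def linear_on_V_scale[OF e] algebra_simps)
  have "(f ^^ Suc k) x = 0" using Suc.prems(3) linear_on_V_0[OF f] by simp
  then have "(f ^^ Suc k) y = 0" using comm[of k] linear_on_V_0[OF e] by (simp add: y_def)
  then have "(f ^^ (k + 2)) y = 0" using linear_on_V_0[OF f] by simp
  moreover have "(e ^^ j) y = 0" using Suc.prems(4) by (simp add: y_def funpow_swap1)
  ultimately have "e x = 0" using Suc.IH[OF y] by (simp add: y_def)
  have "n \<le> k \<Longrightarrow> (f ^^ n) x = 0 \<Longrightarrow> x = 0" for n
  proof (induction n)
    case (Suc n)
    have "scale ((of_nat n + 1) * (of_nat k - of_nat n)) ((f ^^ n) x) = 0"
      using comm[of n] Suc.prems(2) \<open>e x = 0\<close> linear_on_V_0[OF e]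
        linear_on_V_0[OF linear_on_V_funpow[OF f], of "Suc n"] by simp
    moreover have "of_nat n + 1 \<noteq> (0::complex)"
      using of_nat_neq_0[of n, where 'a = complex] by (simp add: add.commute)
    moreover have "of_nat k - of_nat n \<noteq> (0::complex)"
      using Suc.prems(1) by simp
    ultimately have "(f ^^ n) x = 0" by simp
    then show ?case using Suc.IH Suc.prems(1) by simp
  qed simp
  then show ?case using Suc.prems(3) by blast
qed simp

lemma F_funpow_weight:
  "x \<in> weight_space m \<Longrightarrow> (F i ^^ n) x \<in> weight_space (m - smul (int n) (sroot i))"
proof (induction n)
  case (Suc n)
  have "m - smul (int n) (sroot i) - sroot i = m - smul (int (Suc n)) (sroot i)"
    by (simp add: prod_eq_iff smul_def algebra_simps)
  then show ?case using F_weight[OF Suc.IH[OF Suc.prems], of i]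
    by (simp only: funpow.simps comp_apply)
qed (simp add: smul_def flip: zero_prod_def)

lemma E_funpow_weight:
  "x \<in> weight_space m \<Longrightarrow> (E i ^^ n) x \<in> weight_space (m + smul (int n) (sroot i))"
proof (induction n)
  case (Suc n)
  have "m + smul (int n) (sroot i) + sroot i = m + smul (int (Suc n)) (sroot i)"
    by (simp add: prod_eq_iff smul_def algebra_simps)
  then show ?case using E_weight[OF Suc.IH[OF Suc.prems], of i]
    by (simp only: funpow.simps comp_apply)
qed (simp add: smul_def flip: zero_prod_def)

lemma F_commutator_F3:
  assumes "x \<in> V"
  shows "F i (F (\<not> i) x) = F (\<not> i) (F i x) + scale (if i then -1 else 1) (F3 x)"
  using F3_eq[OF assms] by (cases i) simp_all

text \<open>\<open>F3\<close> is up to sign the commutator of the two lowering operators and commutes with both, so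
no higher commutators appear. This transports nilpotency of \<open>F i\<close> along words.\<close>

lemma F_funpow_F:
  assumes x: "x \<in> V"
  shows "(F i ^^ Suc n) (F (\<not> i) x) = F (\<not> i) ((F i ^^ Suc n) x)
    + scale (of_nat (Suc n) * (if i then -1 else 1)) (F3 ((F i ^^ n) x))"
proof (induction n)
  case 0
  then show ?case using F_commutator_F3[OF x, of i] by simp
next
  case (Suc n)
  have V: "(F i ^^ m) x \<in> V" for m
    using linear_on_V_closed[OF linear_on_V_funpow[OF linear_F] x] .
  have "(F i ^^ Suc (Suc n)) (F (\<not> i) x) = F i (F (\<not> i) ((F i ^^ Suc n) x))
      + scale (of_nat (Suc n) * (if i then -1 else 1)) (F3 ((F i ^^ Suc n) x))"
    unfolding funpow.simps(2)[of "Suc n"] comp_apply Suc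
    using V[of "Suc n"] V[of n] by (simp add: op_add op_scale F_F3)
  also have "\<dots> = F (\<not> i) ((F i ^^ Suc (Suc n)) x)
      + scale (of_nat (Suc (Suc n)) * (if i then -1 else 1)) (F3 ((F i ^^ Suc n) x))"
    unfolding F_commutator_F3[OF V, of i]
    by (simp only: add.assoc scale_left_distrib[symmetric] funpow.simps(2)[of "Suc n"] comp_apply)
      (simp add: algebra_simps)
  finally show ?case .
qed

lemma independent_image:
  assumes g: "linear_on_V g" and U: "subspace U" "U \<subseteq> V"
    and inj: "\<And>x. x \<in> U \<Longrightarrow> g x = 0 \<Longrightarrow> x = 0"
    and B: "B \<subseteq> U" "independent B" "finite B"
  shows "inj_on g B" "independent (g ` B)"
proof -
  show injB: "inj_on g B"
  proof (rule inj_onI)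
    fix x y assume "x \<in> B" "y \<in> B" "g x = g y"
    then have "x \<in> U" "y \<in> U" "x \<in> V" "y \<in> V" "g x = g y"
      using B(1) U(2) by blast+
    then have "x - y \<in> U" "g (x - y) = 0"
      using subspace_diff[OF U(1)] linear_on_V_diff[OF g, of x y] by simp_all
    then show "x = y" using inj[of "x - y"] by simp
  qed
  show "independent (g ` B)"
  proof
    assume "dependent (g ` B)"
    then obtain u b where u: "b \<in> B" "u (g b) \<noteq> 0" "(\<Sum>y\<in>g ` B. scale (u y) y) = 0"
      using B(3) by (auto simp: dependent_finite)
    have "g (\<Sum>b\<in>B. scale (u (g b)) b) = (\<Sum>b\<in>B. g (scale (u (g b)) b))"
      using B U by (intro linear_on_V_sum[OF g]) auto
    also have "\<dots> = (\<Sum>b\<in>B. scale (u (g b)) (g b))"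
      using B U by (intro sum.cong refl linear_on_V_scale[OF g]) auto
    also have "\<dots> = 0" using u(3) injB by (simp add: sum.reindex)
    finally have "g (\<Sum>b\<in>B. scale (u (g b)) b) = 0" .
    moreover have "(\<Sum>b\<in>B. scale (u (g b)) b) \<in> U"
      using B U by (intro subspace_sum[OF U(1)] subspace_scale[OF U(1)]) auto
    ultimately have "(\<Sum>b\<in>B. scale (u (g b)) b) = 0" using inj by blast
    then show False
      using B(2,3) u(1,2) by (auto simp: dependent_finite)
  qed
qed

end

locale sl3_irreducible = sl3_module scale V act
  for scale :: "complex \<Rightarrow> 'v::ab_group_add \<Rightarrow> 'v" and V act +
  fixes l :: weight and v :: 'v
  assumes irreducible: "irreducible_module"
    and singular_v: "singular l v"
    and dominant_l: "l \<in> dominant"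
begin

lemma support: "y \<in> weight_space n \<Longrightarrow> y \<noteq> 0 \<Longrightarrow> \<exists>is. word_weight is = l - n"
  using weight_space_support[OF irreducible singular_v] by blast

lemma height_support: "y \<in> weight_space n \<Longrightarrow> y \<noteq> 0 \<Longrightarrow> height n \<le> height l"
  using support[of y n] height_word_weight by (metis height_diff diff_ge_0_iff_ge of_nat_0_le_iff)

definition basis :: "weight \<Rightarrow> 'v set" where
  "basis n = (SOME B. B \<subseteq> weight_space n \<and> independent B \<and> weight_space n \<subseteq> span B
     \<and> card B = dim (weight_space n))"

lemma basis:
  shows "basis n \<subseteq> weight_space n" "independent (basis n)" "span (basis n) = weight_space n"
    "finite (basis n)" "card (basis n) = multiplicity n"
proof -
  have *: "basis n \<subseteq> weight_space n \<and> independent (basis n) \<and> weight_space n \<subseteq> span (basis n)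
     \<and> card (basis n) = dim (weight_space n)"
    unfolding basis_def by (rule someI_ex) (metis basis_exists)
  then show "basis n \<subseteq> weight_space n" "independent (basis n)" "card (basis n) = multiplicity n"
    by (auto simp: multiplicity_def)
  then show "span (basis n) = weight_space n"
    using * span_minimal[OF _ subspace_weight_space] by blast
  show "finite (basis n)"
    using independent_span_bound[of "word v ` {is. word_weight is = l - n}" "basis n"] *
      finite_words[of "l - n"] weight_space_words[OF irreducible singular_v, of n] by auto
qed

lemma multiplicity_nonzeroE:
  assumes "multiplicity n \<noteq> 0"
  obtains y where "y \<in> weight_space n" "y \<noteq> 0"
proof -
  obtain b where "b \<in> basis n" using assms basis(5)[of n] by fastforce
  then show ?thesis using that basis(1,2)[of n] dependent_zero by (metis subsetD)
qed

lemma multiplicity_support: "multiplicity n \<noteq> 0 \<Longrightarrow> \<exists>is. word_weight is = l - n"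
  using multiplicity_nonzeroE support by metis

lemma multiplicity_highest: "multiplicity l = 1"
proof -
  have "is = []" if "word_weight is = 0" for "is"
    using height_word_weight[of "is"] that by (simp add: height_def)
  then have "{is. word_weight is = 0} = {[]}" by auto
  then have "weight_space l = span {v}"
    using weight_space_words[OF irreducible singular_v, of l] by simp
  moreover have "independent {v}"
    using singular_v by (simp add: singular_def)
  ultimately show ?thesis
    using dim_span_eq_card_independent[of "{v}"] by (simp add: multiplicity_def)
qed

lemma E_nilpotent:
  assumes y: "y \<in> weight_space n"
  shows "\<exists>j. (E i ^^ j) y = 0"
proof
  \<comment> \<open>One step more than it takes to reach the height of \<open>l\<close>.\<close>
  define j where "j = nat (height l - height n + 1)"
  have "height (n + smul (int j) (sroot i)) = height n + int j * height (sroot i)"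
    by (simp add: height_def smul_def algebra_simps)
  then have "height (n + smul (int j) (sroot i)) > height l"
    by (simp add: height_sroot j_def)
  then show "(E i ^^ j) y = 0"
    using height_support[OF E_funpow_weight[OF y, of j i]] by linarith
qed

text \<open>If the power of \<open>F i\<close> just above the weight did not kill \<open>v\<close>, it would give a singular
vector of lower weight. By irreducibility all weights would lie at or below that one, but \<open>l\<close>
does not.\<close>

lemma F_nilpotent_highest: "\<exists>n. (F i ^^ n) v = 0"
proof (rule ccontr)
  assume *: "\<not> ?thesis"
  define k where "k = nat (coord i l)"
  have k: "coord i l = int k"
    using dominant_l by (simp add: k_def coord_def dominant_def)
  have v: "v \<in> V" "v \<in> weight_space l" "v \<noteq> 0" "E j v = 0" for j
    using singular_v by (auto simp: singular_def weight_space_V)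
  have "E i ((F i ^^ Suc k) v) = 0"
    using sl2_commutator[of "E i" "F i" "H i" v "of_nat k" k] v H_weight[of v l i]
      linear_on_V_0[OF linear_on_V_funpow[OF linear_F], of "Suc k" i]
    by (simp add: linear_E linear_F E_F H_F coord_sroot k)
  note Ei = this
  have Enot: "E (\<not> i) ((F i ^^ n) v) = 0" for n
  proof (induction n)
    case (Suc n)
    then show ?case
      using E_F[of "(F i ^^ n) v" "\<not> i" i] linear_on_V_closed[OF linear_on_V_funpow[OF linear_F] v(1)]
      by simp
  qed (simp add: v)
  have "E j ((F i ^^ Suc k) v) = 0" for j
  proof (cases "j = i")
    case False
    then have "j = (\<not> i)" by blast
    then show ?thesis using Enot by blast
  qed (use Ei in blast)
  then have "singular (l - smul (int (Suc k)) (sroot i)) ((F i ^^ Suc k) v)"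
    using F_funpow_weight[OF v(2)] * by (simp only: singular_def) blast
  from weight_space_support[OF irreducible this v(2,3)]
  obtain "is" where "word_weight is = - smul (int (Suc k)) (sroot i)" by auto
  then have "height (word_weight is) = - (int (Suc k) * height (sroot i))"
    by (simp add: height_def smul_def algebra_simps)
  then show False using height_word_weight[of "is"] by (simp add: height_sroot)
qed

lemma F_nilpotent:
  assumes "y \<in> V"
  shows "\<exists>n. (F i ^^ n) y = 0"
proof -
  have vV: "v \<in> V" using singular_v by (auto simp: singular_def weight_space_V)
  \<comment> \<open>Annihilation by some power is inherited by higher powers; this allows sums of words to be treated
    with a common exponent.\<close>
  have mono: "(F i ^^ n) z = 0 \<Longrightarrow> n \<le> n' \<Longrightarrow> (F i ^^ n') z = 0" for n n' z
    using linear_on_V_0[OF linear_on_V_funpow[OF linear_F], of "n' - n" i]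
    by (metis comp_apply funpow_add le_add_diff_inverse2)
  have words: "\<exists>n. (F i ^^ n) (word v is) = 0" for "is"
  proof (induction "is")
    case Nil
    then show ?case using F_nilpotent_highest by simp
  next
    case (Cons j "is")
    then obtain n where n: "(F i ^^ n) (word v is) = 0" by blast
    show ?case
    proof (cases "j = i")
      case True
      then have "(F i ^^ n) (word v (j # is)) = F i ((F i ^^ n) (word v is))"
        by (simp add: funpow_swap1)
      then show ?thesis using n by auto
    next
      case False
      then have "j = (\<not> i)" by blast
      then have "(F i ^^ Suc n) (word v (j # is)) = 0"
        using F_funpow_F[OF word_V[OF vV], where n = n and i = i] n by simp
      then show ?thesis by blast
    qed
  qed
  have "y \<in> span (range (word v))"
    using assms span_words[OF irreducible singular_v] by simp
  then have "y \<in> V \<and> (\<exists>n. (F i ^^ n) y = 0)"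
  proof (induction rule: span_induct_alt)
    case base
    then show ?case by (auto intro: exI[of _ 0])
  next
    case (step c x y)
    then obtain "is" n n' where x: "x = word v is" "(F i ^^ n) x = 0" and y: "y \<in> V" "(F i ^^ n') y = 0"
      using words by blast
    have xV: "x \<in> V" using x(1) word_V[OF vV] by simp
    have "(F i ^^ (n + n')) x = 0" "(F i ^^ (n + n')) y = 0"
      using mono[OF x(2)] mono[OF y(2)] by auto
    then have "(F i ^^ (n + n')) (scale c x + y) = 0"
      using xV y(1) linear_on_V_add[OF linear_on_V_funpow[OF linear_F]]
        linear_on_V_scale[OF linear_on_V_funpow[OF linear_F]] by simp
    then show ?case using xV y(1) by blast
  qed
  then show ?thesis by blast
qed

text \<open>Going from \<open>n\<close> to its mirror image means applying the power \<open>\<bar>k\<bar>\<close> of \<open>F i\<close> or of \<open>E i\<close>,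
with \<open>k\<close> the coordinate of \<open>n\<close>, according to the sign of \<open>k\<close>; both are injective.\<close>

lemma multiplicity_reflection_le: "multiplicity n \<le> multiplicity (reflection i n)"
proof -
  define k where "k = nat \<bar>coord i n\<bar>"
  define g where "g = (if coord i n \<ge> 0 then F i ^^ k else E i ^^ k)"
  have g: "linear_on_V g"
    by (simp add: g_def linear_on_V_funpow linear_E linear_F)
  have inj: "x = 0" if x: "x \<in> weight_space n" "g x = 0" for x
  proof (cases "coord i n \<ge> 0")
    case True
    obtain j where "(E i ^^ j) x = 0" using E_nilpotent[OF x(1)] by blast
    then show ?thesis
      using sl2_power_injective[of "E i" "F i" "H i" x k j] x True weight_space_V[OF x(1)]
        H_weight[OF x(1), of i]
      by (simp add: linear_E linear_F E_F H_F H_E coord_sroot g_def k_def)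
  next
    case False
    obtain j where "(F i ^^ j) x = 0" using F_nilpotent[OF weight_space_V[OF x(1)]] by blast
    then show ?thesis
      using sl2_power_injective[of "F i" "E i" "\<lambda>x. - H i x" x k j] x False weight_space_V[OF x(1)]
        H_weight[OF x(1), of i]
      by (simp add: linear_E linear_F E_F H_F H_E coord_sroot g_def k_def linear_on_V_neg)
  qed
  have "reflection i n = (if coord i n \<ge> 0 then n - smul (int k) (sroot i) else n + smul (int k) (sroot i))"
    by (simp add: reflection_eq k_def smul_def prod_eq_iff)
  then have img: "g x \<in> weight_space (reflection i n)" if "x \<in> weight_space n" for x
    using F_funpow_weight[OF that, of k i] E_funpow_weight[OF that, of k i]
    by (simp add: g_def)
  have "inj_on g (basis n)" "independent (g ` basis n)"
    using independent_image[OF g subspace_weight_space _ inj basis(1,2,4)] weight_space_V by blast+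
  moreover have "g ` basis n \<subseteq> span (basis (reflection i n))"
    using img basis(1)[of n] basis(3)[of "reflection i n"] by auto
  ultimately show ?thesis
    using independent_span_bound[OF basis(4)[of "reflection i n"], of "g ` basis n"]
    by (simp add: card_image basis(5))
qed

lemma multiplicity_reflection: "multiplicity (reflection i n) = multiplicity n"
  using multiplicity_reflection_le[of n i] multiplicity_reflection_le[of "reflection i n" i] by simp

end

section \<open>Traces of the Casimir operator\<close>

text \<open>This is 3/2 times the squared length in the Weyl-invariant form for which roots have
squared length 2; the factor makes the values integral.\<close>

definition qnorm :: "weight \<Rightarrow> int" where
  "qnorm m = (fst m)\<^sup>2 + fst m * snd m + (snd m)\<^sup>2"

lemma qnorm_step: "qnorm (m + rho) - qnorm (m - sroot i + rho) = 3 * coord i m"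
  by (cases i) (simp_all add: qnorm_def rho_def sroot_def alpha1_def alpha2_def coord_def
      power2_eq_square algebra_simps)

text \<open>The coefficient at \<open>n\<close> of the product of the Weyl denominator, the alternating sum of the
\<open>exp(w \<rho>)\<close> over the Weyl group, with the formal sum of \<open>g m\<close> times \<open>exp(m)\<close>.\<close>

definition denominator_times :: "(weight \<Rightarrow> 'a::ab_group_add) \<Rightarrow> weight \<Rightarrow> 'a" where
  "denominator_times g n = g (n - (1, 1)) + g (n - (- 2, 1)) + g (n - (1, - 2))
     - (g (n - (- 1, 2)) + g (n - (2, - 1)) + g (n - (- 1, - 1)))"

context sl3_module
begin

text \<open>On each weight space this is half of the Casimir operator up to a scalar: the summands
from the Cartan subalgebra and from the commutators \<open>[e, f]\<close> act there through the weight.\<close>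

definition casimir_plus :: "'v \<Rightarrow> 'v" where
  "casimir_plus x = F True (E True x) + F False (E False x) + F3 (E3 x)"

text \<open>Commuting \<open>F i\<close> past \<open>F (\<not> i)\<close> and past \<open>E3\<close> produces the same term, \<open>F3\<close> after \<open>E (\<not> i)\<close>,
with opposite signs. What is left, from the commutator of \<open>E i\<close> and \<open>F i\<close>, accounts for the
change of the Cartan part of the Casimir operator when the weight drops by a simple root.\<close>

lemma casimir_plus_F:
  assumes "x \<in> V"
  shows "casimir_plus (F i x) = F i (casimir_plus x) + F i (H i x)"
proof (cases i)
  case True
  have "F3 (E False x) = F False (F True (E False x)) - F True (F False (E False x))"
    using F3_eq assms by simp
  then show ?thesis using True assms
    by (simp add: casimir_plus_def E_F E3_F op_add op_diff F_F3 linear_on_V_neg[OF linear_F3])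
next
  case False
  have "F3 (E True x) = F False (F True (E True x)) - F True (F False (E True x))"
    using F3_eq assms by simp
  then show ?thesis using False assms
    by (simp add: casimir_plus_def E_F E3_F op_add op_diff F_F3)
qed

lemma linear_casimir_plus: "linear_on_V casimir_plus"
  by (auto simp: linear_on_V_def casimir_plus_def op_add op_scale algebra_simps)

lemma E3_singular: "singular m x \<Longrightarrow> E3 x = 0"
  using E3_eq[OF weight_space_V, of x m] by (simp add: singular_def)

lemma casimir_plus_word:
  assumes x: "singular m x"
  shows "scale 3 (casimir_plus (word x is)) =
    scale (of_int (qnorm (m + rho) - qnorm (m - word_weight is + rho))) (word x is)"
proof (induction "is")
  case Nil
  then show ?case
    using x E3_singular[OF x] by (simp add: casimir_plus_def singular_def)
next
  case (Cons i "is")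
  have xm: "x \<in> weight_space m" using x by (simp add: singular_def)
  define k where "k = m - word_weight is"
  have w: "word x is \<in> weight_space k" "word x is \<in> V"
    using word_weight_space[OF xm] word_V[OF weight_space_V[OF xm]] by (simp_all add: k_def)
  have "scale 3 (casimir_plus (word x (i # is)))
      = F i (scale 3 (casimir_plus (word x is))) + scale 3 (F i (H i (word x is)))"
    using w(2) linear_on_V_closed[OF linear_casimir_plus]
    by (simp add: casimir_plus_F op_scale scale_right_distrib)
  also have "\<dots> = scale (of_int (qnorm (m + rho) - qnorm (k + rho) + 3 * coord i k)) (F i (word x is))"
    unfolding Cons H_weight[OF w(1)] using w(2)
    by (simp add: op_scale scale_left_distrib k_def)
  also have "qnorm (m + rho) - qnorm (k + rho) + 3 * coord i k
      = qnorm (m + rho) - qnorm (m - word_weight (i # is) + rho)"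
    using qnorm_step[of k i] by (simp add: k_def algebra_simps)
  finally show ?case by simp
qed

definition basis_trace :: "'v set \<Rightarrow> ('v \<Rightarrow> 'v) \<Rightarrow> complex" where
  "basis_trace B g = (\<Sum>b\<in>B. representation B (g b) b)"

lemma basis_trace_add:
  assumes "independent B" "\<And>b. b \<in> B \<Longrightarrow> g b \<in> span B" "\<And>b. b \<in> B \<Longrightarrow> g' b \<in> span B"
  shows "basis_trace B (\<lambda>x. g x + g' x) = basis_trace B g + basis_trace B g'"
  by (simp add: basis_trace_def representation_add assms sum.distrib)

lemma basis_trace_scalar:
  assumes "independent B" "\<And>b. b \<in> B \<Longrightarrow> g b = scale c b"
  shows "basis_trace B g = c * of_nat (card B)"
proof -
  have "basis_trace B g = (\<Sum>b\<in>B. c)"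
    unfolding basis_trace_def
  proof (rule sum.cong[OF refl])
    fix b assume "b \<in> B"
    then show "representation B (g b) b = c"
      using assms representation_scale[of B b c] span_base[of b B] representation_basis[of B b] by simp
  qed
  then show ?thesis by simp
qed

text \<open>The cyclicity of the trace for maps between two different spaces: both sides are the same
double sum over matrix entries.\<close>

lemma basis_trace_swap:
  assumes B: "independent B" "finite B" "B \<subseteq> V" and C: "independent C" "finite C" "C \<subseteq> V"
    and g: "\<And>b. b \<in> B \<Longrightarrow> g b \<in> span C"
    and g': "linear_on_V g'" "\<And>c. c \<in> C \<Longrightarrow> g' c \<in> span B"
    and gl: "linear_on_V g"
  shows "basis_trace B (\<lambda>x. g' (g x)) = basis_trace C (\<lambda>x. g (g' x))"
proof -
  \<comment> \<open>Matrix multiplication: the coordinates of \<open>k (j b)\<close> through the basis \<open>C\<close> in the middle.\<close>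
  have expand: "representation B (k (j b)) a
      = (\<Sum>c\<in>C. representation C (j b) c * representation B (k c) a)"
    if B: "independent B" "finite B" "B \<subseteq> V" and C: "independent C" "finite C" "C \<subseteq> V"
    and j: "j b \<in> span C"
    and k: "linear_on_V k" "\<And>c. c \<in> C \<Longrightarrow> k c \<in> span B" for B C j k a b
  proof -
    have "j b = (\<Sum>c\<in>C. scale (representation C (j b) c) c)"
      using sum_representation_eq[OF C(1) j C(2)] by simp
    then have "k (j b) = k (\<Sum>c\<in>C. scale (representation C (j b) c) c)" by simp
    also have "\<dots> = (\<Sum>c\<in>C. k (scale (representation C (j b) c) c))"
      using C(3) by (intro linear_on_V_sum[OF k(1)]) auto
    also have "\<dots> = (\<Sum>c\<in>C. scale (representation C (j b) c) (k c))"
      using C(3) by (intro sum.cong refl linear_on_V_scale[OF k(1)]) auto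
    finally show ?thesis
      using B(1) k(2) by (simp add: representation_sum representation_scale span_scale)
  qed
  have "basis_trace B (\<lambda>x. g' (g x)) = (\<Sum>b\<in>B. \<Sum>c\<in>C. representation C (g b) c * representation B (g' c) b)"
    unfolding basis_trace_def by (intro sum.cong refl expand B C g g')
  also have "\<dots> = (\<Sum>c\<in>C. \<Sum>b\<in>B. representation B (g' c) b * representation C (g b) c)"
    by (subst sum.swap) (simp add: mult.commute)
  also have "\<dots> = basis_trace C (\<lambda>x. g (g' x))"
    unfolding basis_trace_def by (intro sum.cong refl expand[symmetric] B C g g' gl)
  finally show ?thesis .
qed

end

context sl3_irreducible
begin

lemma casimir_plus_scalar:
  assumes "x \<in> weight_space n"
  shows "scale 3 (casimir_plus x) = scale (of_int (qnorm (l + rho) - qnorm (n + rho))) x"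
proof -
  define S where "S = word v ` {is. word_weight is = l - n}"
  have "x \<in> span S"
    using assms weight_space_words[OF irreducible singular_v, of n] by (simp add: S_def)
  moreover have vV: "v \<in> V" using singular_v by (auto simp: singular_def weight_space_V)
  ultimately have "x \<in> V \<and> ?thesis"
  proof (induction rule: span_induct_alt)
    case base
    then show ?case by (simp add: linear_on_V_0[OF linear_casimir_plus])
  next
    case (step c w y)
    then obtain "is" where w: "w = word v is" "word_weight is = l - n" by (auto simp: S_def)
    then have wV: "w \<in> V" "scale 3 (casimir_plus w) = scale (of_int (qnorm (l + rho) - qnorm (n + rho))) w"
      using casimir_plus_word[OF singular_v, of "is"] word_V[OF vV] by simp_all
    have yV: "y \<in> V" "scale 3 (casimir_plus y) = scale (of_int (qnorm (l + rho) - qnorm (n + rho))) y"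
      using step vV by auto
    have "scale 3 (casimir_plus (scale c w + y))
        = scale c (scale 3 (casimir_plus w)) + scale 3 (casimir_plus y)"
      using wV(1) yV(1)
      by (simp add: linear_on_V_add[OF linear_casimir_plus] linear_on_V_scale[OF linear_casimir_plus]
          scale_right_distrib mult.commute)
    then show ?case
      unfolding wV(2) yV(2) using wV(1) yV(1) by (simp add: scale_right_distrib mult.commute)
  qed
  then show ?thesis by blast
qed

definition trace_FE :: "bool \<Rightarrow> weight \<Rightarrow> real" where
  "trace_FE i n = Re (basis_trace (basis n) (\<lambda>x. F i (E i x)))"

definition trace_FE3 :: "weight \<Rightarrow> real" where
  "trace_FE3 n = Re (basis_trace (basis n) (\<lambda>x. F3 (E3 x)))"

lemma basis_V: "basis n \<subseteq> V"
  using basis(1) weight_space_V by blast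

lemma E3_weight: "x \<in> weight_space m \<Longrightarrow> E3 x \<in> weight_space (m + rho)"
proof -
  assume x: "x \<in> weight_space m"
  have "m + sroot False + sroot True = m + rho" "m + sroot True + sroot False = m + rho"
    by (simp_all add: prod_eq_iff sroot_def alpha1_def alpha2_def rho_def)
  then show ?thesis
    using E_weight[OF E_weight[OF x]] E3_eq[OF weight_space_V[OF x]]
      subspace_diff[OF subspace_weight_space] by metis
qed

lemma F3_weight: "x \<in> weight_space m \<Longrightarrow> F3 x \<in> weight_space (m - rho)"
proof -
  assume x: "x \<in> weight_space m"
  have "m - sroot False - sroot True = m - rho" "m - sroot True - sroot False = m - rho"
    by (simp_all add: prod_eq_iff sroot_def alpha1_def alpha2_def rho_def)
  then show ?thesis
    using F_weight[OF F_weight[OF x]] F3_eq[OF weight_space_V[OF x]]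
      subspace_diff[OF subspace_weight_space] by metis
qed

lemma basis_weight: "b \<in> basis n \<Longrightarrow> b \<in> weight_space n"
  using basis(1) by blast

text \<open>With cyclicity the trace of \<open>g' g\<close> on one weight space becomes that of \<open>g g'\<close> on the next
one, where the commutator is a scalar. Iterating this step would give Freudenthal's sums over
root strings; the difference form is easier to combine with the Weyl denominator.\<close>

lemma trace_step:
  assumes g: "linear_on_V g" "linear_on_V g'"
    and w: "\<And>x. x \<in> weight_space n \<Longrightarrow> g x \<in> weight_space (n + a)"
      "\<And>x m. x \<in> weight_space m \<Longrightarrow> g' x \<in> weight_space (m - a)"
    and w2: "\<And>x. x \<in> weight_space (n + a) \<Longrightarrow> g x \<in> weight_space (n + a + a)"
    and comm: "\<And>x. x \<in> weight_space (n + a) \<Longrightarrow> g (g' x) = g' (g x) + scale (of_int c) x"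
  shows "Re (basis_trace (basis n) (\<lambda>x. g' (g x))) =
    Re (basis_trace (basis (n + a)) (\<lambda>x. g' (g x))) + of_int c * real (multiplicity (n + a))"
proof -
  have na: "n + a - a = n" "n + a + a - a = n + a" by simp_all
  have "basis_trace (basis n) (\<lambda>x. g' (g x)) = basis_trace (basis (n + a)) (\<lambda>x. g (g' x))"
    by (rule basis_trace_swap) (use basis basis_V w(1) w(2)[of _ "n + a"] basis_weight na g in auto)
  also have "\<dots> = basis_trace (basis (n + a)) (\<lambda>x. g' (g x) + scale (of_int c) x)"
    unfolding basis_trace_def by (intro sum.cong refl) (simp add: comm basis_weight)
  also have "\<dots> = basis_trace (basis (n + a)) (\<lambda>x. g' (g x)) + basis_trace (basis (n + a)) (\<lambda>x. scale (of_int c) x)"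
    by (rule basis_trace_add)
      (use basis w2 w(2)[of _ "n + a + a"] basis_weight na
        subspace_scale[OF subspace_weight_space] in auto)
  also have "basis_trace (basis (n + a)) (\<lambda>x. scale (of_int c) x) = of_int c * of_nat (multiplicity (n + a))"
    using basis_trace_scalar[OF basis(2)] basis(5) by metis
  finally show ?thesis by simp
qed

lemma trace_FE_step:
  "trace_FE i n = trace_FE i (n + sroot i)
     + of_int (coord i (n + sroot i)) * real (multiplicity (n + sroot i))"
  unfolding trace_FE_def
  by (rule trace_step) (auto simp: linear_E linear_F E_weight F_weight E_F weight_space_V H_weight)

lemma trace_FE3_step:
  "trace_FE3 n = trace_FE3 (n + rho)
     + of_int (height (n + rho)) * real (multiplicity (n + rho))"
  unfolding trace_FE3_def
  by (rule trace_step) (auto simp: linear_E3 linear_F3 E3_weight F3_weight E3_F3 weight_space_V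
      H_weight height_def coord_def scale_left_distrib)

lemma trace_casimir:
  "3 * (trace_FE True n + trace_FE False n + trace_FE3 n)
     = of_int (qnorm (l + rho) - qnorm (n + rho)) * real (multiplicity n)"
proof -
  let ?c = "qnorm (l + rho) - qnorm (n + rho)"
  have span: "F i (E i b) \<in> span (basis n)" "F3 (E3 b) \<in> span (basis n)" if "b \<in> basis n" for i b
    using F_weight[OF E_weight[OF basis_weight[OF that]], of i i]
      F3_weight[OF E3_weight[OF basis_weight[OF that]]] basis(3) by auto
  have "basis_trace (basis n) (\<lambda>x. F True (E True x) + F False (E False x) + F3 (E3 x))
      = basis_trace (basis n) (\<lambda>x. F True (E True x)) + basis_trace (basis n) (\<lambda>x. F False (E False x))
        + basis_trace (basis n) (\<lambda>x. F3 (E3 x))"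
    by (simp add: basis_trace_add basis(2) span span_add)
  moreover have "basis_trace (basis n) (\<lambda>x. F True (E True x) + F False (E False x) + F3 (E3 x))
      = of_int ?c / 3 * of_nat (card (basis n))"
  proof (rule basis_trace_scalar[OF basis(2)])
    fix b assume "b \<in> basis n"
    then have "scale (1 / 3) (scale 3 (casimir_plus b)) = scale (1 / 3) (scale (of_int ?c) b)"
      using casimir_plus_scalar[OF basis_weight] by simp
    then show "F True (E True b) + F False (E False b) + F3 (E3 b) = scale (of_int ?c / 3) b"
      by (simp add: casimir_plus_def)
  qed
  ultimately have "basis_trace (basis n) (\<lambda>x. F True (E True x)) + basis_trace (basis n) (\<lambda>x. F False (E False x))
        + basis_trace (basis n) (\<lambda>x. F3 (E3 x)) = complex_of_real (of_int ?c * real (multiplicity n) / 3)"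
    by (simp add: basis(5))
  from arg_cong[OF this, of Re] show ?thesis
    by (simp add: trace_FE_def trace_FE3_def)
qed

text \<open>A coefficientwise form of the statement that the Weyl denominator times the character is
an eigenfunction of the Laplacian, with eigenvalue given by the length of \<open>l + \<rho>\<close>. The Casimir
identity holds at the six weights \<open>n - w \<rho>\<close>. For each positive root \<open>\<alpha>\<close> these weights fall into
three pairs on \<open>\<alpha>\<close>-strings, and in the alternating sum the traces telescope along them; the
three contributions at \<open>n\<close> itself, the midpoint of a string for each \<open>\<alpha>\<close>, cancel because the
highest root is the sum of the simple ones.\<close>

theorem denominator_multiplicity_eigen:
  "(qnorm (l + rho) - qnorm n) * denominator_times (\<lambda>m. int (multiplicity m)) n = 0"
proof -
  obtain a b where n: "n = (a, b)" by (cases n)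
  \<comment> \<open>Everything is written in terms of offsets from \<open>n\<close>, so that the instances of the identities below
    share their terms and the conclusion is a linear combination of them.\<close>
  define M where "M x y = real (multiplicity (a + x, b + y))" for x y
  define t where "t i x y = trace_FE i (a + x, b + y)" for i x y
  define t3 where "t3 x y = trace_FE3 (a + x, b + y)" for x y
  define K where "K = real_of_int (qnorm (l + rho))"
  define A B where "A = real_of_int a" and "B = real_of_int b"
  have cas: "3 * (t True x y + t False x y + t3 x y)
      = (K - ((A + x + 1)\<^sup>2 + (A + x + 1) * (B + y + 1) + (B + y + 1)\<^sup>2)) * M x y" for x y
    using trace_casimir[of "(a + x, b + y)"]
    by (simp add: t_def t3_def M_def K_def A_def B_def qnorm_def rho_def algebra_simps)
  have s1: "t True x y = t True (x + 2) (y - 1) + (A + x + 2) * M (x + 2) (y - 1)" for x y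
    using trace_FE_step[of True "(a + x, b + y)"]
    by (simp add: t_def M_def A_def B_def coord_def sroot_def alpha1_def add.assoc
        add_diff_eq[symmetric])
  have s2: "t False x y = t False (x - 1) (y + 2) + (B + y + 2) * M (x - 1) (y + 2)" for x y
    using trace_FE_step[of False "(a + x, b + y)"]
    by (simp add: t_def M_def A_def B_def coord_def sroot_def alpha2_def add.assoc
        add_diff_eq[symmetric])
  have s3: "t3 x y = t3 (x + 1) (y + 1) + (A + B + x + y + 2) * M (x + 1) (y + 1)" for x y
    using trace_FE3_step[of "(a + x, b + y)"]
    by (simp add: t3_def M_def A_def B_def height_def rho_def add.assoc add.left_commute)
  have "(K - (A\<^sup>2 + A * B + B\<^sup>2)) *
     (M (-1) (-1) + M 2 (-1) + M (-1) 2 - (M 1 (-2) + M (-2) 1 + M 1 1)) = 0"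
    \<comment> \<open>The offsets of the Casimir identities are the six \<open>-w \<rho>\<close>; the step identities run along the
      strings between them, with offset \<open>(0, 0)\<close> for the three strings through \<open>n\<close>.\<close>
    using cas[of "-1" "-1"] cas[of 2 "-1"] cas[of "-1" 2] cas[of 1 "-2"] cas[of "-2" 1] cas[of 1 1]
      s1[of "-1" "-1"] s1[of "-2" 1] s1[of 0 0] s1[of "-1" 2]
      s2[of "-1" "-1"] s2[of 1 "-2"] s2[of 0 0] s2[of 2 "-1"]
      s3[of "-1" "-1"] s3[of 0 0] s3[of 1 "-2"] s3[of "-2" 1]
    by (simp add: algebra_simps power2_eq_square)
  then have "real_of_int ((qnorm (l + rho) - qnorm n) * denominator_times (\<lambda>m. int (multiplicity m)) n) = 0"
    by (simp add: n denominator_times_def K_def A_def B_def M_def qnorm_def)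
  then show ?thesis by (simp only: of_int_eq_0_iff)
qed

end

section \<open>Multiplicities depend only on the highest weight\<close>

text \<open>If \<open>d\<close> is not zero, a weight \<open>m\<close> of maximal height in its support is dominant, by
symmetry. At \<open>m + \<rho>\<close> the product with the denominator has the single term \<open>d m\<close>, so \<open>m + \<rho>\<close> and
\<open>l + \<rho>\<close> have the same length. As \<open>m\<close> is dominant and below \<open>l\<close>, this forces \<open>m = l\<close>, where \<open>d\<close>
vanishes.\<close>

lemma denominator_eigen_unique:
  fixes d :: "weight \<Rightarrow> int"
  assumes dom: "l \<in> dominant"
    and sym: "\<And>i n. d (reflection i n) = d n"
    and supp: "\<And>n. d n \<noteq> 0 \<Longrightarrow> \<exists>is. word_weight is = l - n"
    and top: "d l = 0"
    and eig: "\<And>n. (qnorm (l + rho) - qnorm n) * denominator_times d n = 0"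
  shows "d n = 0"
proof (rule ccontr)
  assume "d n \<noteq> 0"
  have le: "height m \<le> height l" if "d m \<noteq> 0" for m
    using supp[OF that] height_word_weight by (metis height_diff diff_ge_0_iff_ge of_nat_0_le_iff)
  obtain m where m: "d m \<noteq> 0" "\<And>k. d k \<noteq> 0 \<Longrightarrow> nat (height l - height m) \<le> nat (height l - height k)"
    using ex_has_least_nat[of "\<lambda>m. d m \<noteq> 0" n "\<lambda>m. nat (height l - height m)"] \<open>d n \<noteq> 0\<close> by blast
  have above: "d k = 0" if "height m < height k" for k
    using m(2)[of k] le[OF m(1)] that le[of k] by fastforce
  have "0 \<le> coord i m" for i
  proof (rule ccontr)
    assume "\<not> 0 \<le> coord i m"
    moreover have "height (reflection i m) = height m - coord i m * height (sroot i)"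
      by (simp add: reflection_eq height_def smul_def algebra_simps)
    ultimately have "d (reflection i m) = 0" by (intro above) (simp add: height_sroot)
    then show False using sym m(1) by simp
  qed
  from this[of True] this[of False] have m0: "0 \<le> fst m" "0 \<le> snd m"
    by (simp_all add: coord_def)
  have "denominator_times d (m + rho) = d m"
    unfolding denominator_times_def by (cases m) (simp add: above height_def rho_def)
  then have q: "qnorm (l + rho) = qnorm (m + rho)"
    using eig[of "m + rho"] m(1) by simp
  obtain a b :: nat where ab: "l - m = (2 * int a - int b, 2 * int b - int a)"
    using supp[OF m(1)] word_weight_eq by metis
  obtain p r where l: "l = (p, r)" by (cases l)
  obtain s t where mst: "m = (s, t)" by (cases m)
  have st: "s = p - 2 * int a + int b" "t = r - 2 * int b + int a"
    using ab by (auto simp: l mst)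
  \<comment> \<open>The difference on the left is 3/2 times the pairing of \<open>l - m\<close>, a sum of positive roots, with the strictly dominant weight
    \<open>l + m + 2\<rho>\<close>, in coordinates.\<close>
  have "2 * (qnorm (l + rho) - qnorm (m + rho)) = 3 * (int a * (p + s + 2) + int b * (r + t + 2))"
    unfolding l mst st qnorm_def rho_def by (simp add: power2_eq_square algebra_simps)
  then have *: "int a * (p + s + 2) + int b * (r + t + 2) = 0" using q by simp
  have pos: "0 < p + s + 2" "0 < r + t + 2"
    using dom m0 by (auto simp: dominant_def l mst)
  then have "0 \<le> int a * (p + s + 2)" "0 \<le> int b * (r + t + 2)" by simp_all
  then have "int a * (p + s + 2) = 0" "int b * (r + t + 2) = 0" using * by linarith+
  then have "a = 0" "b = 0" using pos by simp_all
  then have "m = l" using ab by (simp add: l mst)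
  then show False using top m(1) by simp
qed

definition highest_weight_module :: "weight \<Rightarrow> complex poly set \<Rightarrow> (complex^3^3 \<Rightarrow> complex poly \<Rightarrow> complex poly) \<Rightarrow> bool"
  where "highest_weight_module l V act \<longleftrightarrow> sl3_module Polynomial.smult V act \<and>
     sl3_module.irreducible_module Polynomial.smult V act \<and>
     sl3_module.has_highest_weight Polynomial.smult V act l"

lemma highest_weight_module_irreducible:
  assumes "highest_weight_module l V act" "l \<in> dominant"
  shows "\<exists>v. sl3_irreducible Polynomial.smult V act l v"
proof -
  interpret sl3_module Polynomial.smult V act
    using assms(1) by (simp add: highest_weight_module_def)
  obtain v where v: "v \<in> weight_space l" "v \<noteq> 0" "act (unit_matrix 1 2) v = 0" "act (unit_matrix 2 3) v = 0"
    using assms(1) by (auto simp: highest_weight_module_def has_highest_weight_def)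
  have "sl3_irreducible Polynomial.smult V act l v"
  proof
    show "irreducible_module" using assms(1) by (simp add: highest_weight_module_def)
    show "singular l v" using v by (simp add: singular_def E_def raise_mat_def)
  qed (rule assms(2))
  then show ?thesis ..
qed

text \<open>The difference of the two multiplicity functions satisfies all hypotheses of
\<open>denominator_eigen_unique\<close>, since both take the value 1 at the highest weight.\<close>

lemma multiplicity_unique:
  assumes "highest_weight_module l V act" "highest_weight_module l V' act'" "l \<in> dominant"
  shows "sl3_module.multiplicity Polynomial.smult V act m = sl3_module.multiplicity Polynomial.smult V' act' m"
proof -
  obtain v v' where v: "sl3_irreducible Polynomial.smult V act l v" "sl3_irreducible Polynomial.smult V' act' l v'"
    using highest_weight_module_irreducible assms by blast
  interpret A: sl3_irreducible Polynomial.smult V act l v by (rule v)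
  interpret B: sl3_irreducible Polynomial.smult V' act' l v' by (rule v)
  define d where "d n = int (A.multiplicity n) - int (B.multiplicity n)" for n
  have "d m = 0"
  proof (rule denominator_eigen_unique[OF assms(3)])
    show "(qnorm (l + rho) - qnorm n) * denominator_times d n = 0" for n
    proof -
      have "denominator_times d n = denominator_times (\<lambda>m. int (A.multiplicity m)) n - denominator_times (\<lambda>m. int (B.multiplicity m)) n"
        by (simp add: denominator_times_def d_def)
      then show ?thesis
        using A.denominator_multiplicity_eigen[of n] B.denominator_multiplicity_eigen[of n] by auto
    qed
    show "\<exists>is. word_weight is = l - n" if "d n \<noteq> 0" for n
    proof (cases "A.multiplicity n = 0")
      case True
      then show ?thesis using that B.multiplicity_support[of n] by (simp add: d_def)
    qed (rule A.multiplicity_support)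
  qed (simp_all add: d_def A.multiplicity_reflection B.multiplicity_reflection A.multiplicity_highest B.multiplicity_highest)
  then show ?thesis by (simp add: d_def)
qed

lemma weight_mult_multiplicity:
  assumes "highest_weight_module l V act" "l \<in> dominant"
  shows "weight_mult l m = sl3_module.multiplicity Polynomial.smult V act m"
  unfolding weight_mult_def
proof (rule the_equality)
  show "\<exists>V' act'. sl3_module Polynomial.smult V' act' \<and>
     sl3_module.irreducible_module Polynomial.smult V' act' \<and>
     sl3_module.has_highest_weight Polynomial.smult V' act' l \<and>
     sl3_module.multiplicity Polynomial.smult V act m = sl3_module.multiplicity Polynomial.smult V' act' m"
    using assms(1) unfolding highest_weight_module_def by blast
  fix n assume "\<exists>V' act'. sl3_module Polynomial.smult V' act' \<and>
     sl3_module.irreducible_module Polynomial.smult V' act' \<and>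
     sl3_module.has_highest_weight Polynomial.smult V' act' l \<and>
     n = sl3_module.multiplicity Polynomial.smult V' act' m"
  then obtain V' act' where "highest_weight_module l V' act'"
    "n = sl3_module.multiplicity Polynomial.smult V' act' m"
    unfolding highest_weight_module_def by blast
  then show "n = sl3_module.multiplicity Polynomial.smult V act m"
    using multiplicity_unique[OF _ assms, of V' act'] by blast
qed

text \<open>The properties of the multiplicity function of highest weight \<open>l\<close> from which commutation
is derived.\<close>

definition character_like :: "weight \<Rightarrow> (weight \<Rightarrow> int) \<Rightarrow> bool" where
  "character_like l m \<longleftrightarrow> finite {n. m n \<noteq> 0} \<and> (\<forall>w\<in>weyl. \<forall>n. m (w n) = m n)
     \<and> (\<forall>n. qnorm n \<noteq> qnorm (l + rho) \<longrightarrow> denominator_times m n = 0)"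

text \<open>Being below \<open>l\<close> bounds the support from above in two linear coordinates; the longest
element of the Weyl group turns these into lower bounds.\<close>

lemma finite_symmetric_cone:
  assumes sym: "\<And>i n. m (reflection i n) = m n"
    and supp: "\<And>n. m n \<noteq> 0 \<Longrightarrow> \<exists>is. word_weight is = l - n"
  shows "finite {n. m n \<noteq> (0::int)}"
proof -
  have bound: "2 * fst n + snd n \<le> 2 * fst l + snd l \<and> fst n + 2 * snd n \<le> fst l + 2 * snd l"
    if n: "m n \<noteq> 0" for n
  proof -
    obtain a b :: nat where "l - n = (2 * int a - int b, 2 * int b - int a)"
      using supp[OF n] word_weight_eq by metis
    then have "fst l - fst n = 2 * int a - int b" "snd l - snd n = 2 * int b - int a"
      by (simp_all add: prod_eq_iff)
    then show ?thesis by linarith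
  qed
  define N where "N = \<bar>2 * fst l + snd l\<bar> + \<bar>fst l + 2 * snd l\<bar>"
  have "{n. m n \<noteq> 0} \<subseteq> {- N..N} \<times> {- N..N}"
  proof
    fix n assume n: "n \<in> {n. m n \<noteq> 0}"
    have "reflection True (reflection False (reflection True n)) = (- snd n, - fst n)"
      by (cases n) (simp add: reflection_def s1_apply s2_apply)
    then have "m (- snd n, - fst n) = m n" using sym by metis
    then show "n \<in> {- N..N} \<times> {- N..N}"
      using bound[of n] bound[of "(- snd n, - fst n)"] n by (cases n) (auto simp: N_def)
  qed
  then show ?thesis by (rule finite_subset) simp
qed

lemma weyl_invariant:
  assumes sym: "\<And>i n. m (reflection i n) = m n" and w: "w \<in> weyl"
  shows "m (w n) = m n"
  using w
proof (induction rule: weyl.induct)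
  case (2 w)
  then show ?case using sym[of True "w n"] by (simp add: reflection_def)
next
  case (3 w)
  then show ?case using sym[of False "w n"] by (simp add: reflection_def)
qed simp

lemma weight_mult_character_like:
  assumes l: "l \<in> dominant" and mod: "highest_weight_module l V act"
  shows "character_like l (\<lambda>m. int (weight_mult l m))"
proof -
  obtain v where "sl3_irreducible Polynomial.smult V act l v"
    using highest_weight_module_irreducible[OF mod l] by blast
  then interpret sl3_irreducible Polynomial.smult V act l v .
  have wm: "weight_mult l = multiplicity"
    using weight_mult_multiplicity[OF mod l] by blast
  have sym: "int (multiplicity (reflection i n)) = int (multiplicity n)" for i n
    by (simp add: multiplicity_reflection)
  have supp: "\<exists>is. word_weight is = l - n" if "int (multiplicity n) \<noteq> 0" for n
    using multiplicity_support that by simp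
  have "denominator_times (\<lambda>n. int (multiplicity n)) n = 0" if "qnorm n \<noteq> qnorm (l + rho)" for n
    using denominator_multiplicity_eigen[of n] that by simp
  moreover note finite_symmetric_cone[of "\<lambda>n. int (multiplicity n)" l, OF sym supp]
    weyl_invariant[of "\<lambda>n. int (multiplicity n)", OF sym]
  ultimately show ?thesis
    unfolding character_like_def wm by blast
qed

text \<open>If no module with highest weight \<open>l\<close> lives in the ambient space of polynomials, then the
defining description of \<open>weight_mult l m\<close> denotes one unspecified number, the same for all \<open>m\<close>.
Together with \<open>chi_constant_zero\<close> this settles the commutation of the corresponding character.\<close>

lemma weight_mult_constant:
  assumes "\<nexists>V act. highest_weight_module l V act"
  shows "weight_mult l m = weight_mult l n"
proof -
  have "(\<exists>V act. sl3_module Polynomial.smult V act \<and>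
     sl3_module.irreducible_module Polynomial.smult V act \<and>
     sl3_module.has_highest_weight Polynomial.smult V act l \<and>
     k = sl3_module.multiplicity Polynomial.smult V act m) = False" for k m
    using assms unfolding highest_weight_module_def by blast
  then show ?thesis by (simp only: weight_mult_def)
qed

section \<open>Truncated convolutions on the weight lattice\<close>

abbreviation coef :: "('a \<Rightarrow>\<^sub>0 'b::zero) \<Rightarrow> 'a \<Rightarrow> 'b" where
  "coef \<equiv> poly_mapping.lookup"

lemma sum_single_lookup: "(\<Sum>z\<in>Poly_Mapping.keys g. Poly_Mapping.single z (coef g z)) = g"
proof (rule poly_mapping_eqI)
  fix k
  show "coef (\<Sum>z\<in>Poly_Mapping.keys g. Poly_Mapping.single z (coef g z)) k = coef g k"
    by (cases "k \<in> Poly_Mapping.keys g") (simp_all add: lookup_sum lookup_single when_def in_keys_iff)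
qed

lemma lookup_times_single:
  fixes f :: "'a::group_add \<Rightarrow>\<^sub>0 int"
  shows "coef (f * Poly_Mapping.single z c) x = coef f (x - z) * c"
proof -
  have "(\<Sum>q. coef (Poly_Mapping.single z c) q when x = k + q) = (c when k = x - z)" for k
  proof -
    have "(\<Sum>q. coef (Poly_Mapping.single z c) q when x = k + q) = (\<Sum>q. (c when x = k + z) when q = z)"
      by (rule Sum_any.cong) (auto simp: lookup_single when_def)
    then show ?thesis by (auto simp: when_def algebra_simps)
  qed
  then show ?thesis by (simp add: lookup_mult mult_when)
qed

lemma lookup_times:
  fixes f g :: "'a::group_add \<Rightarrow>\<^sub>0 int"
  assumes "finite S" "Poly_Mapping.keys g \<subseteq> S"
  shows "coef (f * g) x = (\<Sum>z\<in>S. coef f (x - z) * coef g z)"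
proof -
  have "coef (f * g) x = coef (\<Sum>z\<in>Poly_Mapping.keys g. f * Poly_Mapping.single z (coef g z)) x"
    by (simp add: sum_single_lookup flip: sum_distrib_left)
  also have "\<dots> = (\<Sum>z\<in>Poly_Mapping.keys g. coef f (x - z) * coef g z)"
    by (simp add: lookup_sum lookup_times_single)
  also have "\<dots> = (\<Sum>z\<in>S. coef f (x - z) * coef g z)"
    using assms by (intro sum.mono_neutral_left) (auto simp: in_keys_iff)
  finally show ?thesis .
qed

text \<open>The classes of \<open>0\<close> and \<open>\<rho>\<close> of the root lattice modulo \<open>3P\<close>. The class of a weight in the
root lattice is the residue of its first coordinate, and the missing class is that of \<open>-\<rho>\<close>.\<close>

definition honeycomb :: "weight set" where
  "honeycomb = {n. 3 dvd fst n - snd n \<and> fst n mod 3 \<noteq> 2}"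

text \<open>The part of \<open>m\<close> in the root lattice with class in \<open>R\<close>, as an element of the group ring of
the weight lattice.\<close>

definition class_part :: "int set \<Rightarrow> (weight \<Rightarrow> int) \<Rightarrow> (weight \<Rightarrow>\<^sub>0 int)" where
  "class_part R m = Abs_poly_mapping (\<lambda>n. if 3 dvd fst n - snd n \<and> fst n mod 3 \<in> R then m n else 0)"

lemma lookup_class_part:
  assumes "finite {n. m n \<noteq> 0}"
  shows "coef (class_part R m) n = (if 3 dvd fst n - snd n \<and> fst n mod 3 \<in> R then m n else 0)"
proof -
  have "finite {n. (if 3 dvd fst n - snd n \<and> fst n mod 3 \<in> R then m n else 0) \<noteq> 0}"
    by (rule finite_subset[OF _ assms]) auto
  then show ?thesis by (simp add: class_part_def)
qed

text \<open>The sums of \<open>exp(w \<rho>)\<close> over the even and the odd elements \<open>w\<close> of the Weyl group; their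
difference is the Weyl denominator. The first has class 1 modulo \<open>3P\<close>, the second class 2.\<close>

definition orbit_even :: "weight \<Rightarrow>\<^sub>0 int" where
  "orbit_even = Poly_Mapping.single (1, 1) 1 + Poly_Mapping.single (- 2, 1) 1 + Poly_Mapping.single (1, - 2) 1"

definition orbit_odd :: "weight \<Rightarrow>\<^sub>0 int" where
  "orbit_odd = Poly_Mapping.single (- 1, 2) 1 + Poly_Mapping.single (2, - 1) 1 + Poly_Mapping.single (- 1, - 1) 1"

lemma lookup_orbit_even:
  "coef (orbit_even * f) n = coef f (n - (1, 1)) + coef f (n - (- 2, 1)) + coef f (n - (1, - 2))"
  unfolding mult.commute[of orbit_even f]
  by (simp add: orbit_even_def distrib_left lookup_add lookup_times_single)

lemma lookup_orbit_odd:
  "coef (orbit_odd * f) n = coef f (n - (- 1, 2)) + coef f (n - (2, - 1)) + coef f (n - (- 1, - 1))"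
  unfolding mult.commute[of orbit_odd f]
  by (simp add: orbit_odd_def distrib_left lookup_add lookup_times_single)

text \<open>The term \<open>\<rho>\<close> of \<open>orbit_even\<close> is strictly higher than the other two, so a term of maximal
height of \<open>f\<close> cannot cancel in the product.\<close>

lemma orbit_even_cancel:
  assumes "orbit_even * f = 0"
  shows "f = 0"
proof (rule ccontr)
  assume "f \<noteq> 0"
  then have ne: "Poly_Mapping.keys f \<noteq> {}" by simp
  then have "Max (height ` Poly_Mapping.keys f) \<in> height ` Poly_Mapping.keys f"
    by (intro Max_in) auto
  then obtain m where m: "m \<in> Poly_Mapping.keys f" "height m = Max (height ` Poly_Mapping.keys f)"
    by auto
  then have max: "height n \<le> height m" if "n \<in> Poly_Mapping.keys f" for n
    using that by simp
  have above: "coef f n = 0" if "height m < height n" for n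
    using max[of n] that by (auto simp: in_keys_iff)
  have "coef f m = coef (orbit_even * f) (m + (1, 1))"
    unfolding lookup_orbit_even by (simp add: above height_def)
  then show False using m(1) assms by (simp add: in_keys_iff)
qed

text \<open>Both products are supported on \<open>3P\<close>, and there they are the two halves of the product with
the Weyl denominator.\<close>

lemma denominator_zero_relation:
  assumes fin: "finite {n. m n \<noteq> 0}"
    and denom: "\<And>n. 3 dvd fst n \<Longrightarrow> 3 dvd snd n \<Longrightarrow> denominator_times m n = 0"
  shows "orbit_even * class_part {2} m = orbit_odd * class_part {1} m"
proof (rule poly_mapping_eqI)
  fix n :: weight
  obtain a b where n: "n = (a, b)" by (cases n)
  show "coef (orbit_even * class_part {2} m) n = coef (orbit_odd * class_part {1} m) n"
  proof (cases "3 dvd a \<and> 3 dvd b")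
    case True
    then obtain i j where ij: "a = 3 * i" "b = 3 * j" by (auto elim!: dvdE)
    have "(3 * i - 1) mod 3 = 2" "(3 * i + 2) mod 3 = 2" "(3 * i + 1) mod 3 = 1" "(3 * i - 2) mod 3 = 1"
      "3 dvd (3 * i - 3 * j)" "3 dvd (3 * i + 3 - 3 * j)" "3 dvd (3 * i - (3 * j + 3))"
      by presburger+
    then show ?thesis
      using denom[of n] unfolding lookup_orbit_even lookup_orbit_odd
      by (simp add: lookup_class_part[OF fin] n ij denominator_times_def)
  next
    case False
    have even: "coef (class_part {2} m) (n - (x, y)) = 0" if "x mod 3 = 1" "y mod 3 = 1" for x y
    proof -
      have "\<not> (3 dvd (a - x) - (b - y) \<and> (a - x) mod 3 = 2)"
        using False that by presburger
      then show ?thesis by (auto simp: lookup_class_part[OF fin] n)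
    qed
    have odd: "coef (class_part {1} m) (n - (x, y)) = 0" if "x mod 3 = 2" "y mod 3 = 2" for x y
    proof -
      have "\<not> (3 dvd (a - x) - (b - y) \<and> (a - x) mod 3 = 1)"
        using False that by presburger
      then show ?thesis by (auto simp: lookup_class_part[OF fin] n)
    qed
    show ?thesis
      unfolding lookup_orbit_even lookup_orbit_odd
      using even[of 1 1] even[of "- 2" 1] even[of 1 "- 2"] odd[of "- 1" 2] odd[of 2 "- 1"] odd[of "- 1" "- 1"]
      by simp
  qed
qed

text \<open>This is where commutativity comes from: the commutator reduces to products of parts in the
classes 1 and 2, and those become equal after multiplication with \<open>orbit_even\<close>.\<close>

lemma honeycomb_convolution_commute:
  assumes fin: "finite {n. m n \<noteq> 0}" "finite {n. m' n \<noteq> 0}"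
    and denom: "\<And>n. 3 dvd fst n \<Longrightarrow> 3 dvd snd n \<Longrightarrow> denominator_times m n = 0"
      "\<And>n. 3 dvd fst n \<Longrightarrow> 3 dvd snd n \<Longrightarrow> denominator_times m' n = 0"
    and x: "x \<in> honeycomb"
  shows "coef (class_part UNIV m * class_part {0, 1} m') x = coef (class_part UNIV m' * class_part {0, 1} m) x"
proof -
  have split1: "class_part {0, 1} m = class_part {0} m + class_part {1} m" if fin: "finite {n. m n \<noteq> 0}" for m
    by (rule poly_mapping_eqI) (auto simp: lookup_add lookup_class_part[OF fin])
  have split2: "class_part UNIV m = class_part {0, 1} m + class_part {2} m" if fin: "finite {n. m n \<noteq> 0}" for m
  proof (rule poly_mapping_eqI)
    fix n :: weight
    have "fst n mod 3 = 0 \<or> fst n mod 3 = 1 \<or> fst n mod 3 = 2" by presburger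
    then show "coef (class_part UNIV m) n = coef (class_part {0, 1} m + class_part {2} m) n"
      by (auto simp: lookup_add lookup_class_part[OF fin])
  qed
  \<comment> \<open>A product of classes 2 and 0 has class 2, outside the honeycomb.\<close>
  have zero: "coef (class_part {2} m * class_part {0} m') x = 0"
    if fin: "finite {n. m n \<noteq> 0}" "finite {n. m' n \<noteq> 0}" for m m'
  proof -
    have "coef (class_part {2} m) (x - z) * coef (class_part {0} m') z = 0" for z
      using x by (cases x; cases z) (auto simp: lookup_class_part fin honeycomb_def; presburger)
    then show ?thesis unfolding lookup_times[OF finite_keys order_refl] by (intro sum.neutral) blast
  qed
  have rel: "orbit_even * class_part {2} m = orbit_odd * class_part {1} m"
      "orbit_even * class_part {2} m' = orbit_odd * class_part {1} m'"
    by (rule denominator_zero_relation, rule fin, rule denom, assumption+)+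
  have "orbit_even * (class_part {2} m * class_part {1} m' - class_part {2} m' * class_part {1} m)
      = (orbit_even * class_part {2} m) * class_part {1} m' - (orbit_even * class_part {2} m') * class_part {1} m"
    by (simp add: algebra_simps)
  also have "\<dots> = 0"
    unfolding rel
    by (simp add: algebra_simps)
  finally have eq: "class_part {2} m * class_part {1} m' = class_part {2} m' * class_part {1} m"
    using orbit_even_cancel by fastforce
  have "class_part UNIV m * class_part {0, 1} m' - class_part UNIV m' * class_part {0, 1} m
      = class_part {2} m * class_part {0} m' - class_part {2} m' * class_part {0} m
        + (class_part {2} m * class_part {1} m' - class_part {2} m' * class_part {1} m)"
    unfolding split2[OF fin(1)] split2[OF fin(2)] split1[OF fin(1)] split1[OF fin(2)]
    by (simp add: algebra_simps)
  then have "coef (class_part UNIV m * class_part {0, 1} m' - class_part UNIV m' * class_part {0, 1} m) x = 0"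
    using zero[OF fin] zero[OF fin(2) fin(1)] eq by (simp add: lookup_add lookup_minus)
  then show ?thesis by (simp add: lookup_minus)
qed

section \<open>Cosets of the affine Weyl group\<close>

lemma weyl_cases:
  assumes "w \<in> weyl"
  shows "(\<forall>a b. w (a, b) = (a, b)) \<or> (\<forall>a b. w (a, b) = (- a, a + b)) \<or> (\<forall>a b. w (a, b) = (a + b, - b))
    \<or> (\<forall>a b. w (a, b) = (- a - b, a)) \<or> (\<forall>a b. w (a, b) = (b, - a - b)) \<or> (\<forall>a b. w (a, b) = (- b, - a))"
  using assms
proof (induction rule: weyl.induct)
  case (2 w)
  from "2.IH" show ?case by (elim disjE) (simp_all add: s1_apply)
next
  case (3 w)
  from "3.IH" show ?case by (elim disjE) (simp_all add: s2_apply)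
qed simp

lemma weyl_elements:
  "(\<lambda>(a, b). (a, b)) \<in> weyl" "(\<lambda>(a, b). (- a, a + b)) \<in> weyl" "(\<lambda>(a, b). (a + b, - b)) \<in> weyl"
  "(\<lambda>(a, b). (- a - b, a)) \<in> weyl" "(\<lambda>(a, b). (b, - a - b)) \<in> weyl" "(\<lambda>(a, b). (- b, - a)) \<in> weyl"
proof -
  have *: "(\<lambda>(a, b). (a, b)) = id" "(\<lambda>(a, b). (- a, a + b)) = s1" "(\<lambda>(a, b). (a + b, - b)) = s2"
    "(\<lambda>(a, b). (- a - b, a)) = s1 \<circ> s2" "(\<lambda>(a, b). (b, - a - b)) = s2 \<circ> s1"
    "(\<lambda>(a, b). (- b, - a)) = s1 \<circ> (s2 \<circ> s1)"
    by (auto simp: fun_eq_iff s1_apply s2_apply)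
  show "(\<lambda>(a, b). (a, b)) \<in> weyl" "(\<lambda>(a, b). (- a, a + b)) \<in> weyl" "(\<lambda>(a, b). (a + b, - b)) \<in> weyl"
    "(\<lambda>(a, b). (- a - b, a)) \<in> weyl" "(\<lambda>(a, b). (b, - a - b)) \<in> weyl" "(\<lambda>(a, b). (- b, - a)) \<in> weyl"
    unfolding * by (intro weyl.intros(1) weyl_s1 weyl_s2 weyl_comp)+
qed

text \<open>The class of a weight in \<open>P / Q\<close>, which has three elements.\<close>

definition triality :: "weight \<Rightarrow> int" where
  "triality m = (fst m - snd m) mod 3"

lemma triality_add: "triality (m + n) = (triality m + triality n) mod 3"
  by (simp add: triality_def mod_add_eq algebra_simps)

lemma triality_diff: "triality (m - n) = (triality m - triality n) mod 3"
  by (simp add: triality_def mod_diff_eq algebra_simps)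

lemma triality_weyl:
  assumes "w \<in> weyl" shows "triality (w m) = triality m"
proof (cases m)
  case (Pair a b)
  then show ?thesis
    using weyl_cases[OF assms] by (auto simp: triality_def) presburger+
qed

lemma root_lattice_iff: "m \<in> root_lattice \<longleftrightarrow> triality m = 0"
proof
  assume "m \<in> root_lattice"
  then show "triality m = 0"
    by (auto simp: root_lattice_def triality_def smul_def alpha1_def alpha2_def)
next
  assume *: "triality m = 0"
  obtain a b where m: "m = (a, b)" by (cases m)
  obtain k where "a - b = 3 * k"
    using * by (auto simp: triality_def m elim: dvdE)
  then have "m = smul (b + 2 * k) alpha1 + smul (b + k) alpha2"
    by (simp add: m smul_def alpha1_def alpha2_def)
  then show "m \<in> root_lattice" unfolding root_lattice_def by blast
qed

definition coset_class :: "ext_weyl \<Rightarrow> int" where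
  "coset_class y = triality (trans_part y)"

lemma coset_class_plus: "coset_class (x + y) = (coset_class x + coset_class y) mod 3"
  by (simp add: coset_class_def trans_part_plus triality_add triality_weyl fin_part_weyl weyl_inv)

lemma coset_class_range: "0 \<le> coset_class y" "coset_class y < 3"
  by (simp_all add: coset_class_def triality_def)

lemma orbit_iff: "z \<in> orbit y \<longleftrightarrow> coset_class z = coset_class y"
proof
  assume "z \<in> orbit y"
  then obtain u where "z = u + y" "coset_class u = 0"
    by (auto simp: orbit_def affine_weyl_def root_lattice_iff coset_class_def)
  then show "coset_class z = coset_class y"
    using coset_class_range[of y] by (simp add: coset_class_plus)
next
  assume *: "coset_class z = coset_class y"
  have "coset_class ((z - y) + y) = (coset_class (z - y) + coset_class y) mod 3"
    by (rule coset_class_plus)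
  then have "coset_class (z - y) = 0"
    using * coset_class_range[of "z - y"] coset_class_range[of y] by simp presburger
  then have "z - y \<in> affine_weyl" by (simp add: affine_weyl_def root_lattice_iff coset_class_def)
  moreover have "z = (z - y) + y" by simp
  ultimately show "z \<in> orbit y" unfolding orbit_def by blast
qed

lemma iota_eq: "iota y = inv_into UNIV (fin_part y) rho - rho - smul 3 (trans_part y)"
  by (simp add: iota_def dot_def smul_def)

lemma smul_weyl: "w \<in> weyl \<Longrightarrow> w (smul k m) = smul k (w m)"
  using weyl_cases[of w] by (cases m) (auto simp: smul_def algebra_simps)

lemma weyl_diff: "w \<in> weyl \<Longrightarrow> w (m - n) = w m - w n"
  using weyl_add[of w m "- n"] weyl_uminus[of w n] by simp

text \<open>The cocycle property, on which the formula for products of characters rests.\<close>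

lemma iota_plus: "iota (x + y) = inv_into UNIV (fin_part y) (iota x) + iota y"
proof -
  have w: "inv_into UNIV (fin_part y) \<in> weyl" "bij (fin_part x)" "bij (fin_part y)"
    using fin_part_weyl weyl_inv weyl_bij by blast+
  have "smul 3 (m + n) = smul 3 m + smul 3 n" for m n by (simp add: smul_def algebra_simps)
  then show ?thesis
    using w by (simp add: iota_eq fin_part_plus trans_part_plus weyl_diff smul_weyl o_inv_distrib)
qed

lemma iota_honeycomb: "iota y \<in> honeycomb"
proof -
  have "inv_into UNIV (fin_part y) \<in> weyl" using fin_part_weyl weyl_inv by blast
  from weyl_cases[OF this] show ?thesis
    by (auto simp: iota_eq honeycomb_def rho_def smul_def) presburger+
qed

text \<open>The six weights \<open>w \<rho>\<close> are pairwise incongruent modulo \<open>3Q\<close>.\<close>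

lemma weyl_eqI:
  assumes "w \<in> weyl" "w' \<in> weyl" "w rho - w' rho = smul 3 m" "triality m = 0"
  shows "w = w'"
proof -
  let ?S = "{(1, 1), (- 1, 2), (2, - 1), (- 2, 1), (1, - 2), (- 1, - 1)} :: weight set"
  have rho: "w (1, 1) \<in> ?S" if "w \<in> weyl" for w
    using weyl_cases[OF that] by auto
  have "x = x' \<and> y = y'"
    if "(x, y) \<in> ?S" "(x', y') \<in> ?S" "x - x' = 3 * a" "y - y' = 3 * b" "(a - b) mod 3 = 0"
    for x x' y y' a b :: int
    using that by (auto; presburger)
  from this[of "fst (w (1, 1))" "snd (w (1, 1))" "fst (w' (1, 1))" "snd (w' (1, 1))" "fst m" "snd m"]
  have eq: "w (1, 1) = w' (1, 1)"
    using rho[OF assms(1)] rho[OF assms(2)] assms(3,4)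
    by (simp add: triality_def rho_def smul_def prod_eq_iff)
  have "w (p, q) = w' (p, q)" for p q
    using weyl_cases[OF assms(1)] weyl_cases[OF assms(2)] eq by (elim disjE) simp_all
  then show ?thesis by (auto simp: fun_eq_iff)
qed

lemma inj_on_iota: "inj_on iota (orbit y)"
proof (rule inj_onI)
  fix z z' assume z: "z \<in> orbit y" "z' \<in> orbit y" "iota z = iota z'"
  let ?w = "inv_into UNIV (fin_part z)" and ?w' = "inv_into UNIV (fin_part z')"
  have eq: "?w rho - ?w' rho = smul 3 (trans_part z - trans_part z')"
    using z(3) by (simp add: iota_eq smul_def prod_eq_iff)
  have "triality (trans_part z) = triality (trans_part z')"
    using z(1,2) by (simp add: orbit_iff coset_class_def)
  then have "triality (trans_part z - trans_part z') = 0"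
    by (simp add: triality_diff)
  then have w: "?w = ?w'"
    by (rule weyl_eqI[OF weyl_inv[OF fin_part_weyl] weyl_inv[OF fin_part_weyl] eq])
  then have "smul 3 (trans_part z - trans_part z') = 0" using eq by simp
  then have "trans_part z = trans_part z'" by (simp add: smul_def prod_eq_iff)
  moreover have "fin_part z = fin_part z'"
    using arg_cong[OF w, of "inv_into UNIV"] by (simp add: inv_inv_eq fin_part_weyl weyl_bij)
  ultimately show "z = z'" by (intro ext_weyl_eqI)
qed

text \<open>The even elements \<open>w\<close> have \<open>w \<rho>\<close> in the class of \<open>\<rho>\<close>, the odd ones in the class of \<open>-\<rho>\<close>;
so the class of \<open>n\<close> decides the sign of \<open>w\<close>. The three elements of that sign give translations
of three different trialities, and \<open>c\<close> selects one of them.\<close>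

lemma honeycomb_translation:
  assumes "n \<in> honeycomb" "0 \<le> c" "c < 3"
  shows "\<exists>w\<in>weyl. \<exists>t. n = w rho - rho - smul 3 t \<and> triality t = c"
proof -
  obtain a b where n: "n = (a, b)" by (cases n)
  have d: "3 dvd a - b" "a mod 3 = 0 \<or> a mod 3 = 1"
    using assms(1) by (auto simp: honeycomb_def n)
  define i j where "i = a div 3" and "j = b div 3"
  define r where "r = a mod 3"
  have ij: "a = 3 * i + r" "b = 3 * j + r"
    using d(1) unfolding i_def j_def r_def by presburger+
  have c: "(j - i) mod 3 = c \<or> (j - i + 1) mod 3 = c \<or> (j - i - 1) mod 3 = c"
  proof -
    have "c = 0 \<or> c = 1 \<or> c = 2" using assms(2,3) by auto
    moreover have "(d mod 3 = c \<or> (d + 1) mod 3 = c \<or> (d - 1) mod 3 = c)"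
      if "c = 0 \<or> c = 1 \<or> c = 2" for d
      using that by (elim disjE; simp only:; presburger)
    ultimately show ?thesis by blast
  qed
  have ex: "\<exists>w\<in>weyl. \<exists>t. n = w rho - rho - smul 3 t \<and> triality t = c"
    if "w \<in> weyl" "w (1, 1) = (1 + a + 3 * k, 1 + b + 3 * m)" "(k - m) mod 3 = c" for w k m
  proof (rule bexI[OF exI[of _ "(k, m)"] that(1)])
    show "n = w rho - rho - smul 3 (k, m) \<and> triality (k, m) = c"
      using that(2,3) by (simp add: n rho_def smul_def triality_def)
  qed
  from d(2) have "r = 0 \<or> r = 1" by (simp add: r_def)
  then show ?thesis
  proof
    assume r: "r = 0"
    from c show ?thesis
    proof (elim disjE)
      assume "(j - i) mod 3 = c"
      then show ?thesis by (intro ex[OF weyl_elements(1), of "- i" "- j"]) (simp_all add: ij r algebra_simps)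
    next
      assume "(j - i + 1) mod 3 = c"
      then show ?thesis by (intro ex[OF weyl_elements(5), of "- i" "- j - 1"]) (simp_all add: ij r algebra_simps)
    next
      assume "(j - i - 1) mod 3 = c"
      then show ?thesis by (intro ex[OF weyl_elements(4), of "- i - 1" "- j"]) (simp_all add: ij r algebra_simps)
    qed
  next
    assume r: "r = 1"
    from c show ?thesis
    proof (elim disjE)
      assume "(j - i) mod 3 = c"
      then show ?thesis by (intro ex[OF weyl_elements(6), of "- i - 1" "- j - 1"]) (simp_all add: ij r algebra_simps)
    next
      assume "(j - i + 1) mod 3 = c"
      then show ?thesis by (intro ex[OF weyl_elements(3), of "- i" "- j - 1"]) (simp_all add: ij r algebra_simps)
    next
      assume "(j - i - 1) mod 3 = c"
      then show ?thesis by (intro ex[OF weyl_elements(2), of "- i - 1" "- j"]) (simp_all add: ij r algebra_simps)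
    qed
  qed
qed

lemma ext_weyl_exists:
  assumes "w \<in> weyl"
  shows "\<exists>z. fin_part z = w \<and> trans_part z = t"
proof -
  have "(w, t) \<in> weyl \<times> UNIV" using assms by simp
  then show ?thesis
    by (intro exI[of _ "Abs_ext_weyl (w, t)"])
      (simp add: fin_part.rep_eq trans_part.rep_eq Abs_ext_weyl_inverse)
qed

text \<open>The image is the same for all cosets, so sums over a coset turn into sums over the
honeycomb.\<close>

lemma bij_betw_iota: "bij_betw iota (orbit y) honeycomb"
proof -
  have "n \<in> iota ` orbit y" if n: "n \<in> honeycomb" for n
  proof -
    obtain w t where w: "w \<in> weyl" "n = w rho - rho - smul 3 t" "triality t = coset_class y"
      using honeycomb_translation[OF n coset_class_range[of y]] by blast
    obtain z where z: "fin_part z = inv_into UNIV w" "trans_part z = t"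
      using ext_weyl_exists[OF weyl_inv[OF w(1)]] by blast
    have "iota z = n" using w z by (simp add: iota_eq inv_inv_eq weyl_bij)
    moreover have "z \<in> orbit y" using w z by (simp add: orbit_iff coset_class_def)
    ultimately show ?thesis by blast
  qed
  then show ?thesis
    using inj_on_iota iota_honeycomb by (auto simp: bij_betw_def)
qed

lemma iota_dominant:
  assumes "y \<in> W_plus"
  shows "iota y \<in> dominant"
proof -
  obtain a b where t: "trans_part y = (- a, - b)"
    by (metis add.inverse_inverse prod.collapse)
  define w where "w = inv_into UNIV (fin_part y)"
  have w: "w \<in> weyl" by (simp add: w_def fin_part_weyl weyl_inv)
  have "fin_part y (w m) = m" for m
    unfolding w_def by (simp add: fin_part_weyl weyl_bij bij_is_surj surj_f_inv_f)
  note fw = this[of "(2, -1)"] this[of "(-1, 2)"] this[of "(-2, 1)"] this[of "(1, -2)"]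
    this[of "(1, 1)"] this[of "(-1, -1)"]
  have "0 \<le> a" "0 \<le> b" "fin_part y (2, -1) \<in> negative_roots \<Longrightarrow> 0 < a"
    "fin_part y (-1, 2) \<in> negative_roots \<Longrightarrow> 0 < b"
    using assms by (auto simp: W_plus_def t dominant_def alpha1_def alpha2_def)
  then show ?thesis
    using weyl_cases[OF w] fw
    by (auto simp: iota_eq t dominant_def rho_def smul_def negative_roots_def alpha1_def alpha2_def
        simp flip: w_def)
qed

text \<open>Since \<open>\<iota>(y) + \<rho>\<close> is \<open>w \<rho>\<close> modulo \<open>3P\<close> and \<open>qnorm (w \<rho>) = 3\<close>, the value is 3 modulo 9.\<close>

lemma qnorm_iota: "\<not> 9 dvd qnorm (iota y + rho)"
proof -
  define w where "w = inv_into UNIV (fin_part y)"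
  have w: "w \<in> weyl" by (simp add: w_def fin_part_weyl weyl_inv)
  obtain a b where t: "trans_part y = (a, b)" by (cases "trans_part y")
  have "\<exists>k. qnorm (iota y + rho) = 9 * k + 3"
  proof -
    have "\<exists>p q. iota y + rho = (p - 3 * a, q - 3 * b) \<and> (p, q) \<in> {(1, 1), (- 1, 2), (2, - 1), (- 2, 1), (1, - 2), (- 1, - 1)}"
      using weyl_cases[OF w] by (auto simp: iota_eq t rho_def smul_def simp flip: w_def)
    then obtain p q where pq: "iota y + rho = (p - 3 * a, q - 3 * b)"
      "(p, q) \<in> {(1, 1), (- 1, 2), (2, - 1), (- 2, 1), (1, - 2), (- 1, - 1)}" by blast
    have *: "qnorm (iota y + rho) = 9 * (a * a + a * b + b * b) - 3 * (a * (2 * p + q) + b * (p + 2 * q))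
        + (p * p + p * q + q * q)"
      unfolding pq(1) qnorm_def by (simp add: power2_eq_square algebra_simps)
    from pq(2) have "p * p + p * q + q * q = 3 \<and> (\<exists>i. 2 * p + q = 3 * i) \<and> (\<exists>j. p + 2 * q = 3 * j)"
      by (auto; presburger)
    then obtain i j where "p * p + p * q + q * q = 3" "2 * p + q = 3 * i" "p + 2 * q = 3 * j" by blast
    then have "qnorm (iota y + rho) = 9 * (a * a + a * b + b * b - (a * i + b * j)) + 3"
      unfolding * by (simp add: algebra_simps)
    then show ?thesis by blast
  qed
  then show ?thesis by presburger
qed

text \<open>On \<open>3P\<close> the values of \<open>qnorm\<close> are multiples of 9.\<close>

lemma denominator_character_like:
  assumes "character_like (iota y) m" "3 dvd fst n" "3 dvd snd n"
  shows "denominator_times m n = 0"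
proof -
  obtain i j where "n = (3 * i, 3 * j)" using assms(2,3) by (cases n) (auto elim!: dvdE)
  then have "qnorm n = 9 * (i * i + i * j + j * j)"
    by (simp add: qnorm_def power2_eq_square algebra_simps)
  then have "9 dvd qnorm n" by (rule dvdI)
  then have "qnorm n \<noteq> qnorm (iota y + rho)" using qnorm_iota[of y] by metis
  then show ?thesis using assms(1) unfolding character_like_def by blast
qed

section \<open>Products of characters\<close>

lemma lookup_chi:
  assumes "character_like (iota y) (\<lambda>m. int (weight_mult (iota y) m))"
  shows "coef (chi y) z = (if z \<in> orbit y then int (weight_mult (iota y) (iota z)) else 0)"
proof -
  let ?S = "{z \<in> orbit y. weight_mult (iota y) (iota z) \<noteq> 0}"
  have "finite ?S"
  proof (rule inj_on_finite)
    show "inj_on iota ?S" by (rule inj_on_subset[OF inj_on_iota]) auto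
    show "iota ` ?S \<subseteq> {n. int (weight_mult (iota y) n) \<noteq> 0}" by auto
    show "finite {n. int (weight_mult (iota y) n) \<noteq> 0}" using assms by (simp add: character_like_def)
  qed
  then show ?thesis
    by (auto simp: chi_def lookup_sum lookup_single when_def)
qed

text \<open>Either no term is nonzero or all terms of the infinite coset are, and a sum over an
infinite set is zero by convention.\<close>

lemma chi_constant_zero:
  assumes "\<And>m n. weight_mult (iota y) m = weight_mult (iota y) n"
  shows "chi y = 0"
proof (cases "weight_mult (iota y) 0 = 0")
  case True
  then have "weight_mult (iota y) (iota z) = 0" for z using assms[of "iota z" 0] by simp
  then have "{z \<in> orbit y. weight_mult (iota y) (iota z) \<noteq> 0} = {}" by simp
  then show ?thesis by (simp only: chi_def sum.empty)
next
  case False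
  have "infinite (range (\<lambda>k::nat. (3 * int k, 0::int)))"
    by (rule range_inj_infinite) (auto simp: inj_def)
  moreover have "range (\<lambda>k::nat. (3 * int k, 0)) \<subseteq> honeycomb" by (auto simp: honeycomb_def)
  ultimately have "infinite honeycomb" using finite_subset by blast
  then have "infinite (orbit y)" using bij_betw_finite[OF bij_betw_iota] by blast
  moreover have "weight_mult (iota y) (iota z) \<noteq> 0" for z
    using assms[of "iota z" 0] False by simp
  then have "{z \<in> orbit y. weight_mult (iota y) (iota z) \<noteq> 0} = orbit y" by simp
  ultimately show ?thesis by (simp add: chi_def)
qed

lemma iota_diff: "iota x - iota z = inv_into UNIV (fin_part z) (iota (x - z))"
  using iota_plus[of "x - z" z] by simp

text \<open>By the cocycle property \<open>\<iota>(x - z)\<close> and \<open>\<iota>(x) - \<iota>(z)\<close> differ by a Weyl group element, which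
the multiplicities do not see. The product therefore becomes a convolution on the weight
lattice, in which the second factor is truncated to the honeycomb.\<close>

lemma coef_chi_times_chi:
  assumes m: "character_like (iota y) (\<lambda>m. int (weight_mult (iota y) m))"
    and m': "character_like (iota y') (\<lambda>m. int (weight_mult (iota y') m))"
  shows "coef (chi y * chi y') x =
    (if x \<in> orbit (y + y')
     then coef (class_part UNIV (\<lambda>m. int (weight_mult (iota y) m)) * class_part {0, 1} (\<lambda>m. int (weight_mult (iota y') m))) (iota x)
     else 0)"
proof -
  let ?m = "\<lambda>m. int (weight_mult (iota y) m)" and ?m' = "\<lambda>m. int (weight_mult (iota y') m)"
  let ?K = "Poly_Mapping.keys (chi y')"
  have fin: "finite {n. ?m n \<noteq> 0}" "finite {n. ?m' n \<noteq> 0}"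
    using m m' by (simp_all add: character_like_def)
  have K: "z \<in> orbit y'" if "z \<in> ?K" for z
    using that by (auto simp: in_keys_iff lookup_chi[OF m'] split: if_splits)
  have prod: "coef (chi y * chi y') x = (\<Sum>z\<in>?K. coef (chi y) (x - z) * coef (chi y') z)"
    by (rule lookup_times) auto
  have diff_orbit: "x - z \<in> orbit y \<longleftrightarrow> x \<in> orbit (y + y')" if "z \<in> orbit y'" for z
  proof -
    have "coset_class x = (coset_class (x - z) + coset_class z) mod 3"
      using coset_class_plus[of "x - z" z] by simp
    moreover have "(u + c) mod 3 = (v + c) mod 3 \<longleftrightarrow> u = v"
      if "0 \<le> u" "u < 3" "0 \<le> v" "v < 3" for u v c :: int
    proof -
      have "(u + c) mod 3 = (v + c) mod 3 \<longleftrightarrow> 3 dvd u - v" by (simp add: mod_eq_dvd_iff)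
      also have "\<dots> \<longleftrightarrow> u - v = 0"
        using that zdvd_not_zless[of "u - v" 3] zdvd_not_zless[of "v - u" 3]
        by (cases u v rule: linorder_cases) (auto simp: dvd_diff_commute[of 3 u v])
      finally show ?thesis by simp
    qed
    ultimately show ?thesis
      using that coset_class_range by (simp add: orbit_iff coset_class_plus)
  qed
  show ?thesis
  proof (cases "x \<in> orbit (y + y')")
    case False
    then have "coef (chi y) (x - z) = 0" if "z \<in> ?K" for z
      using diff_orbit[OF K[OF that]] by (simp add: lookup_chi[OF m])
    then show ?thesis using False prod by simp
  next
    case True
    have even: "fst n mod 3 \<in> {0, 1}" "3 dvd fst n - snd n" if "n \<in> honeycomb" for n
      using that by (auto simp: honeycomb_def)
    have summand: "coef (chi y) (x - z) * coef (chi y') z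
        = coef (class_part UNIV ?m) (iota x - iota z) * coef (class_part {0, 1} ?m') (iota z)" if z: "z \<in> ?K" for z
    proof -
      have "coef (chi y) (x - z) = ?m (iota (x - z))"
        using diff_orbit[OF K[OF z]] True by (simp add: lookup_chi[OF m])
      also have "\<dots> = ?m (iota x - iota z)"
        using m unfolding character_like_def iota_diff by (metis fin_part_weyl weyl_inv)
      also have "\<dots> = coef (class_part UNIV ?m) (iota x - iota z)"
        using even(2)[OF iota_honeycomb[of x]] even(2)[OF iota_honeycomb[of z]]
        by (simp add: lookup_class_part[OF fin(1)]) presburger
      finally show ?thesis
        using even[OF iota_honeycomb[of z]] K[OF z] by (simp add: lookup_chi[OF m'] lookup_class_part[OF fin(2)])
    qed
    have "Poly_Mapping.keys (class_part {0, 1} ?m') \<subseteq> iota ` ?K"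
    proof
      fix n assume "n \<in> Poly_Mapping.keys (class_part {0, 1} ?m')"
      then have n: "n \<in> honeycomb" "?m' n \<noteq> 0"
        by (auto simp: in_keys_iff lookup_class_part[OF fin(2)] honeycomb_def split: if_splits)
      have "n \<in> iota ` orbit y'"
        using n(1) bij_betw_imp_surj_on[OF bij_betw_iota[of y']] by simp
      then obtain z where "z \<in> orbit y'" "iota z = n" by blast
      then show "n \<in> iota ` ?K" using n(2) by (auto simp: in_keys_iff lookup_chi[OF m'])
    qed
    then have "coef (class_part UNIV ?m * class_part {0, 1} ?m') (iota x)
        = (\<Sum>n\<in>iota ` ?K. coef (class_part UNIV ?m) (iota x - n) * coef (class_part {0, 1} ?m') n)"
      by (intro lookup_times) auto
    also have "\<dots> = (\<Sum>z\<in>?K. coef (class_part UNIV ?m) (iota x - iota z) * coef (class_part {0, 1} ?m') (iota z))"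
      using inj_on_subset[OF inj_on_iota[of y'], of ?K] K by (subst sum.reindex) auto
    also have "\<dots> = coef (chi y * chi y') x"
      unfolding prod by (rule sum.cong[OF refl summand[symmetric]])
    finally show ?thesis using True by simp
  qed
qed

lemma chi_commute:
  assumes "y \<in> W_plus" "y' \<in> W_plus"
  shows "chi y * chi y' = chi y' * chi y"
proof -
  have dichotomy: "chi y = 0 \<or> character_like (iota y) (\<lambda>m. int (weight_mult (iota y) m))"
    if "y \<in> W_plus" for y
  proof (cases "\<exists>V act. highest_weight_module (iota y) V act")
    case True
    then show ?thesis using weight_mult_character_like[OF iota_dominant[OF that]] by blast
  next
    case False
    then have "chi y = 0" by (rule chi_constant_zero[OF weight_mult_constant])
    then show ?thesis ..
  qed
  show ?thesis
  proof (cases "chi y = 0 \<or> chi y' = 0")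
    case False
    then have c: "character_like (iota y) (\<lambda>m. int (weight_mult (iota y) m))"
      "character_like (iota y') (\<lambda>m. int (weight_mult (iota y') m))"
      using dichotomy assms by blast+
    have "orbit (y + y') = orbit (y' + y)"
      by (auto simp: orbit_iff coset_class_plus add.commute)
    moreover have "coef (class_part UNIV (\<lambda>m. int (weight_mult (iota y) m)) * class_part {0, 1} (\<lambda>m. int (weight_mult (iota y') m))) (iota x)
      = coef (class_part UNIV (\<lambda>m. int (weight_mult (iota y') m)) * class_part {0, 1} (\<lambda>m. int (weight_mult (iota y) m))) (iota x)" for x
      using c by (intro honeycomb_convolution_commute denominator_character_like iota_honeycomb)
        (auto simp: character_like_def)
    ultimately show ?thesis
      by (intro poly_mapping_eqI) (simp add: coef_chi_times_chi c)
  qed auto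
qed

lemma ring_group_ring: "ring group_ring"
proof (rule ringI)
  show "abelian_group group_ring"
  proof (rule abelian_groupI)
    show "\<exists>y\<in>carrier group_ring. y \<oplus>\<^bsub>group_ring\<^esub> x = \<zero>\<^bsub>group_ring\<^esub>" for x
      by (rule bexI[of _ "- x"]) (simp_all add: group_ring_def)
  qed (simp_all add: group_ring_def algebra_simps)
  show "Group.monoid group_ring"
    by (rule monoidI) (simp_all add: group_ring_def algebra_simps)
qed (simp_all add: group_ring_def algebra_simps)

lemma (in ring) generate_ring_commute:
  assumes H: "H \<subseteq> carrier R" and comm: "\<And>g h. g \<in> H \<Longrightarrow> h \<in> H \<Longrightarrow> g \<otimes> h = h \<otimes> g"
    and x: "x \<in> generate_ring R H" and y: "y \<in> generate_ring R H"
  shows "x \<otimes> y = y \<otimes> x"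
proof -
  have C: "a \<in> generate_ring R H \<Longrightarrow> a \<in> carrier R" for a
    using generate_ring_in_carrier[OF H] .
  have step: "a \<otimes> b = b \<otimes> a"
    if b: "b \<in> carrier R" and bH: "\<And>h. h \<in> H \<Longrightarrow> h \<otimes> b = b \<otimes> h" and a: "a \<in> generate_ring R H" for a b
    using a
  proof (induction rule: generate_ring.induct)
    case (a_inv h)
    then show ?case using b C by (simp add: l_minus r_minus)
  next
    case (eng_add h1 h2)
    then show ?case using b C by (simp add: l_distr r_distr)
  next
    case (eng_mult h1 h2)
    then have "h1 \<in> carrier R" "h2 \<in> carrier R" using C by blast+
    then show ?case using b eng_mult.IH by (metis m_assoc)
  qed (use b bH in simp_all)
  have "h \<otimes> x = x \<otimes> h" if "h \<in> H" for h
    using step[of h x] x that H comm by auto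
  then show ?thesis
    using step[of x y] x y C by simp
qed

theorem proposition4p1:
  shows "cring character_ring"
proof -
  interpret ring group_ring by (rule ring_group_ring)
  let ?H = "{chi y | y. y \<in> W_plus}"
  have H: "?H \<subseteq> carrier group_ring" by (simp add: group_ring_def)
  have "ring character_ring"
    unfolding character_ring_def by (rule generate_ring_is_ring[OF H])
  moreover have "x \<otimes>\<^bsub>group_ring\<^esub> y = y \<otimes>\<^bsub>group_ring\<^esub> x"
    if "x \<in> generate_ring group_ring ?H" "y \<in> generate_ring group_ring ?H" for x y
    by (rule generate_ring_commute[OF H _ that]) (auto simp: group_ring_def chi_commute)
  ultimately show ?thesis
    by (intro cring.intro comm_monoid.intro comm_monoid_axioms.intro ring.is_monoid)
      (simp_all add: character_ring_def)
qed

end
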